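(* Let $n\ge 5$. For a generic simplex $\Delta^n\subset\mathbb{R}^n$ with vertices $p_0,\dots,p_n$, any simplex in $\mathbb{R}^n$ with vertices $p_0',\dots,p_n'$ such that $\mathrm{area}(p_i'p_j'p_k')=\mathrm{area}(p_ip_jp_k)$ for all $0\le i<j<k\le n$ is congruent to $\Delta^n$.
   Context: Simplices are non-degenerate and have labelled vertices. Congruence means that there is an isometry of $\mathbb{R}^n$ taking $p_i$ to $p_i'$ for every $i$. "Generic" means that there is a non-zero real polynomial $f$ (depending only on $n$) in the $\binom{n+1}{2}$ squares of edge lengths such that the assertion holds for all simplices at which $f$ does not vanish. *)

theory Defs
  imports "HOL-Analysis.Analysis" "HOL-Library.Poly_Mapping"
begin

text \<open>
  A polynomial over the reals in indeterminates from \<open>'v\<close> is a finitely supported map from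
  monomials (finitely supported exponent functions) to coefficients; its ring structure is that of
  \<^theory>\<open>HOL-Library.Poly_Mapping\<close>, so \<open>f \<noteq> 0\<close> below means non-zero as a formal polynomial.
\<close>
type_synonym 'v rpoly = "('v \<Rightarrow>\<^sub>0 nat) \<Rightarrow>\<^sub>0 real"

definition indets :: "'v rpoly \<Rightarrow> 'v set" where
  "indets f = (\<Union>m\<in>Poly_Mapping.keys f. Poly_Mapping.keys m)"

definition rpoly_eval :: "('v \<Rightarrow> real) \<Rightarrow> 'v rpoly \<Rightarrow> real" where
  "rpoly_eval x f =
     (\<Sum>m\<in>Poly_Mapping.keys f.
        Poly_Mapping.lookup f m * (\<Prod>v\<in>Poly_Mapping.keys m. x v ^ Poly_Mapping.lookup m v))"

definition edges :: "nat \<Rightarrow> (nat \<times> nat) set" where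
  "edges n = {(i, j). i < j \<and> j \<le> n}"

definition sq_edge_length :: "(nat \<Rightarrow> 'a::metric_space) \<Rightarrow> nat \<times> nat \<Rightarrow> real" where
  "sq_edge_length p = (\<lambda>(i, j). (dist (p i) (p j))\<^sup>2)"

text \<open>
  A simplex with labelled vertices \<open>p 0, \<dots>, p n\<close>; values of \<open>p\<close> beyond \<open>n\<close> play no role.
  Injectivity is needed because \<^const>\<open>affine_dependent\<close> only sees the set of vertices.
\<close>
definition labelled_simplex :: "nat \<Rightarrow> (nat \<Rightarrow> 'a::real_vector) \<Rightarrow> bool" where
  "labelled_simplex n p \<longleftrightarrow> inj_on p {..n} \<and> \<not> affine_dependent (p ` {..n})"

definition congruent_simplices ::
    "nat \<Rightarrow> (nat \<Rightarrow> 'a::metric_space) \<Rightarrow> (nat \<Rightarrow> 'a) \<Rightarrow> bool" where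
  "congruent_simplices n p p' \<longleftrightarrow>
     (\<exists>g. bij g \<and> (\<forall>x y. dist (g x) (g y) = dist x y) \<and> (\<forall>i\<le>n. g (p i) = p' i))"

text \<open>
  Two-dimensional area of a triangle in a space of any dimension: half the area of the
  parallelogram spanned by two sides, the latter being the square root of their Gram determinant.
\<close>
definition triangle_area :: "'a::real_inner \<Rightarrow> 'a \<Rightarrow> 'a \<Rightarrow> real" where
  "triangle_area a b c =
     sqrt ((norm (b - a))\<^sup>2 * (norm (c - a))\<^sup>2 - ((b - a) \<bullet> (c - a))\<^sup>2) / 2"

lemma triangle_area_dist:
  "triangle_area a b c =
     sqrt ((dist a b)\<^sup>2 * (dist a c)\<^sup>2
           - (((dist a b)\<^sup>2 + (dist a c)\<^sup>2 - (dist b c)\<^sup>2) / 2)\<^sup>2) / 2"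
proof -
  have "(b - a) \<bullet> (c - a) = ((dist a b)\<^sup>2 + (dist a c)\<^sup>2 - (dist b c)\<^sup>2) / 2"
    by (simp add: dist_norm power2_norm_eq_inner inner_diff inner_commute)
  then show ?thesis
    unfolding triangle_area_def by (simp only: dist_norm norm_minus_commute)
qed

lemma triangle_area_plane:
  fixes a b c :: "real ^ 2"
  shows "triangle_area a b c = measure lebesgue (convex hull {a, b, c})"
proof -
  have "(norm (b - a))\<^sup>2 * (norm (c - a))\<^sup>2 - ((b - a) \<bullet> (c - a))\<^sup>2
      = ((c $ 1 - a $ 1) * (b $ 2 - a $ 2) - (b $ 1 - a $ 1) * (c $ 2 - a $ 2))\<^sup>2"
    unfolding power2_norm_eq_inner inner_vec_def sum_2 vector_minus_component inner_real_def
    by algebra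
  then have "triangle_area a b c = measure lborel (convex hull {a, b, c})"
    by (simp add: triangle_area_def content_triangle)
  moreover have "convex hull {a, b, c} \<in> sets borel"
    by (intro borel_closed compact_imp_closed finite_imp_compact_convex_hull) simp
  ultimately show ?thesis
    by simp
qed

text \<open>
  Hence \<^const>\<open>triangle_area\<close> is the planar Lebesgue measure of the triangle, transported along
  any isometric embedding of the plane.
\<close>
lemma triangle_area_isometric_copy:
  fixes h :: "real ^ 2 \<Rightarrow> 'a::real_inner"
  assumes "\<And>x y. dist (h x) (h y) = dist x y"
  shows "triangle_area (h a) (h b) (h c) = measure lebesgue (convex hull {a, b, c})"
  by (metis assms triangle_area_dist triangle_area_plane)

end

theory Submission
  imports Defs "HOL-Library.Function_Algebras"
begin

text \<open>
  Write \<open>x\<^sub>i\<^sub>j\<close> and \<open>y\<^sub>i\<^sub>j\<close> for the squared edge lengths of the two simplices. By Heron's formula, equal areas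
  mean that \<open>4 x\<^sub>i\<^sub>k x\<^sub>i\<^sub>l - (x\<^sub>i\<^sub>k + x\<^sub>i\<^sub>l - x\<^sub>k\<^sub>l)\<^sup>2\<close> does not change when \<open>x\<close> is replaced by \<open>y\<close>, for
  every triangle \<open>i k l\<close>. The claim is that the pairs \<open>(x, y)\<close> with \<open>x \<noteq> y\<close> form a set of such small
  dimension that the entries of \<open>x\<close> are algebraically dependent on it; a polynomial relation between
  them is the required \<open>f\<close>. Equal edge lengths then give an isometry by linear algebra.

  The dimension count adds the edges one by one. An edge brings two coordinates, and a triangle
  that it completes brings one equation: an edge raises the dimension by \<open>2\<close> if it completes no
  triangle and by \<open>1\<close> if it completes one. If it completes two triangles, then \<open>(x\<^sub>k\<^sub>l, y\<^sub>k\<^sub>l)\<close> lies on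
  two hyperbolas with asymptotes of slopes \<open>1\<close> and \<open>-1\<close>, whose centres differ for generic \<open>x\<close>; in general
  these meet in finitely many points, and the dimension is not raised at all. So a tetrahedron has dimension at most
  \<open>2 + 2 + 1 + 2 + 1 + 0 = 8\<close>, joining a fifth vertex to it adds \<open>2 + 1 + 0 + 0 = 3\<close>, joining a sixth adds
  another \<open>3\<close>, and the edge between these last two adds nothing. That makes \<open>14\<close>, while six vertices
  have \<open>15\<close> edges.

  The two hyperbolas have a common component only if \<open>y\<^sub>i\<^sub>k y\<^sub>i\<^sub>l = x\<^sub>i\<^sub>k x\<^sub>i\<^sub>l\<close> and \<open>y\<^sub>j\<^sub>k y\<^sub>j\<^sub>l = x\<^sub>j\<^sub>k x\<^sub>j\<^sub>l\<close>
  (\<open>two_hyperbolas\<close>). Such a relation is itself an equation that lowers the dimension elsewhere, and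
  the bound survives (\<open>growth_tetrahedron\<close>, \<open>growth_vertex\<close>) unless so many of these relations hold
  that they force \<open>x = y\<close> (\<open>all_recip_imp_agree\<close>, \<open>agree_if_unexceptional\<close>). Positivity of squared
  lengths excludes the other solution \<open>y = - x\<close> of the area equations.

  Dimension is measured by a growth exponent: the polynomials of degree at most \<open>D\<close> in the given
  functions, restricted to a set, lie in the span of \<open>O(D\<^sup>d)\<close> functions. This notion is preserved
  by finite unions of sets, so that every degenerate position can be split off where it occurs, and
  adding a root of a quadratic equation does not change the exponent, even if the leading coefficient
  is only known to have no zeros (\<open>growth_le_insert_quadratic\<close>).
\<close>

section \<open>Polynomials in a set of functions and their growth on a subset\<close>

text \<open>
  The index is only an upper bound for the degree of some expression of the function as a polynomial
  in \<open>Z\<close>.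
\<close>
inductive poly_of :: "('s \<Rightarrow> real) set \<Rightarrow> nat \<Rightarrow> ('s \<Rightarrow> real) \<Rightarrow> bool" for Z where
  const: "poly_of Z D (\<lambda>_. c)"
| gen: "z \<in> Z \<Longrightarrow> poly_of Z (Suc D) z"
| add: "poly_of Z D f \<Longrightarrow> poly_of Z D g \<Longrightarrow> poly_of Z D (\<lambda>s. f s + g s)"
| mult: "poly_of Z D f \<Longrightarrow> poly_of Z E g \<Longrightarrow> poly_of Z (D + E) (\<lambda>s. f s * g s)"

lemma poly_of_add_degree: "poly_of Z D f \<Longrightarrow> poly_of Z (D + k) f"
proof (induction rule: poly_of.induct)
  case (mult D f E g)
  then show ?case
    using poly_of.mult[of Z "D + k" f E g] by (simp add: ac_simps)
qed (auto intro: poly_of.intros)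

lemma poly_of_mono: "poly_of Z D f \<Longrightarrow> D \<le> E \<Longrightarrow> poly_of Z E f"
  using poly_of_add_degree[of Z D f "E - D"] by simp

lemma poly_of_mono_set: "poly_of Z D f \<Longrightarrow> Z \<subseteq> W \<Longrightarrow> poly_of W D f"
  by (induction rule: poly_of.induct) (auto intro: poly_of.intros)

lemma poly_of_cmult: "poly_of Z D f \<Longrightarrow> poly_of Z D (\<lambda>s. c * f s)"
  using poly_of.mult[OF poly_of.const[of Z 0 c]] by simp

lemma poly_of_uminus: "poly_of Z D f \<Longrightarrow> poly_of Z D (\<lambda>s. - f s)"
  using poly_of_cmult[of Z D f "-1"] by simp

lemma poly_of_diff: "poly_of Z D f \<Longrightarrow> poly_of Z D g \<Longrightarrow> poly_of Z D (\<lambda>s. f s - g s)"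
  using poly_of.add[OF _ poly_of_uminus, of Z D f g] by simp

lemma poly_of_sum:
  "finite I \<Longrightarrow> (\<And>i. i \<in> I \<Longrightarrow> poly_of Z D (f i)) \<Longrightarrow> poly_of Z D (\<lambda>s. \<Sum>i\<in>I. f i s)"
  by (induction I rule: finite_induct) (auto intro: poly_of.intros)

lemma poly_of_power: "poly_of Z k f \<Longrightarrow> poly_of Z (k * i) (\<lambda>s. f s ^ i)"
  by (induction i) (auto intro: poly_of.intros)

lemma poly_of_empty: "poly_of {} D f \<Longrightarrow> \<exists>c. f = (\<lambda>_. c)"
  by (induction rule: poly_of.induct) auto

lemma poly_of_insert_expand:
  "poly_of (insert y Z) D f \<Longrightarrow>
    \<exists>h. (\<forall>i. poly_of Z D (h i)) \<and> f = (\<lambda>s. \<Sum>i\<le>D. h i s * y s ^ i)"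
proof (induction rule: poly_of.induct)
  case (const D c)
  show ?case
    by (rule exI[of _ "\<lambda>i s. if i = 0 then c else 0"])
       (auto intro: poly_of.const simp: if_distrib if_distribR sum.If_cases cong: if_cong)
next
  case (gen z D)
  show ?case
  proof (cases "z = y")
    case True
    show ?thesis
      by (rule exI[of _ "\<lambda>i s. if i = 1 then 1 else 0"])
         (auto simp: True intro: poly_of.const simp: if_distrib if_distribR sum.If_cases cong: if_cong)
  next
    case False
    then have "poly_of Z (Suc D) z"
      using gen by (auto intro: poly_of.gen)
    then have "poly_of Z (Suc D) (\<lambda>s. if i = 0 then z s else 0)" for i :: nat
      by (cases "i = 0") (auto intro: poly_of.const)
    then show ?thesis
      by (intro exI[of _ "\<lambda>i s. if i = 0 then z s else 0"])
         (auto simp: if_distrib if_distribR sum.If_cases cong: if_cong)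
  qed
next
  case (add D f g)
  then obtain h k where "\<forall>i. poly_of Z D (h i)" "f = (\<lambda>s. \<Sum>i\<le>D. h i s * y s ^ i)"
    "\<forall>i. poly_of Z D (k i)" "g = (\<lambda>s. \<Sum>i\<le>D. k i s * y s ^ i)" by auto
  then show ?case
    by (intro exI[of _ "\<lambda>i s. h i s + k i s"])
       (auto intro: poly_of.add simp: sum.distrib distrib_right)
next
  case (mult D f E g)
  then obtain h k where h: "\<forall>i. poly_of Z D (h i)" "f = (\<lambda>s. \<Sum>i\<le>D. h i s * y s ^ i)"
    and k: "\<forall>i. poly_of Z E (k i)" "g = (\<lambda>s. \<Sum>i\<le>E. k i s * y s ^ i)" by auto
  define h' where "h' i s = (if i \<le> D then h i s else 0)" for i s
  define k' where "k' i s = (if i \<le> E then k i s else 0)" for i s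
  have h': "poly_of Z D (h' i)" and k': "poly_of Z E (k' i)" for i
    unfolding h'_def k'_def using h k
    by (cases "i \<le> D"; cases "i \<le> E"; simp add: poly_of.const)+
  have "f s * g s = (\<Sum>r\<le>D + E. (\<Sum>j\<le>r. h' j s * k' (r - j) s) * y s ^ r)" for s
  proof -
    have "f s = (\<Sum>i\<le>D. h' i s * y s ^ i)" "g s = (\<Sum>i\<le>E. k' i s * y s ^ i)"
      by (auto simp: h k h'_def k'_def intro!: sum.cong)
    then show ?thesis
      using polynomial_product[of D "\<lambda>i. h' i s" E "\<lambda>i. k' i s" "y s"]
      by (simp add: h'_def k'_def)
  qed
  moreover have "poly_of Z (D + E) (\<lambda>s. \<Sum>j\<le>r. h' j s * k' (r - j) s)" for r
    by (intro poly_of_sum poly_of.mult h' k') auto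
  ultimately show ?case
    by (intro exI[of _ "\<lambda>r s. \<Sum>j\<le>r. h' j s * k' (r - j) s"]) auto
qed

global_interpretation fs: vector_space "\<lambda>(c::real) (f :: 's \<Rightarrow> real) s. c * f s"
  by unfold_locales (auto simp: algebra_simps fun_eq_iff)

lemma sum_fun_apply: "(\<Sum>i\<in>I. (F i :: 's \<Rightarrow> real)) s = (\<Sum>i\<in>I. F i s)"
  by (induction I rule: infinite_finite_induct) auto

text \<open>
  Multiplication by a fixed function is linear. The factor may be the reciprocal of a function or
  the indicator of a set; this is how denominators and unions of sets are handled below.
\<close>
lemma span_times:
  assumes "f \<in> fs.span B"
  shows "(\<lambda>s. u s * f s) \<in> fs.span ((\<lambda>b s. u s * b s) ` B)"
  using assms
proof (induction rule: fs.span_induct_alt)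
  case base
  then show ?case using fs.span_zero by (simp add: zero_fun_def)
next
  case (step c x y)
  have "(\<lambda>s. u s * ((\<lambda>s. c * x s) + y) s) = (\<lambda>s. c * (u s * x s)) + (\<lambda>s. u s * y s)"
    by (auto simp: algebra_simps)
  moreover have "(\<lambda>s. u s * x s) \<in> fs.span ((\<lambda>b s. u s * b s) ` B)"
    using step by (intro fs.span_base) auto
  ultimately show ?case
    using fs.span_add[OF fs.span_scale[of _ _ c] step.IH] by simp
qed

definition cut :: "'s set \<Rightarrow> ('s \<Rightarrow> real) \<Rightarrow> 's \<Rightarrow> real" where
  "cut S f = (\<lambda>s. if s \<in> S then f s else 0)"

text \<open>
  For the coordinate functions on a non-empty set \<open>S\<close> of points in affine space, the number of functions
  needed is the affine Hilbert function of the Zariski closure of \<open>S\<close>, and the least \<open>d\<close> is its dimension.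
  The spanning functions are arbitrary, so they may have denominators.
\<close>
definition growth_le :: "'s set \<Rightarrow> ('s \<Rightarrow> real) set \<Rightarrow> nat \<Rightarrow> bool" where
  "growth_le S Z d \<longleftrightarrow> (\<exists>C. \<forall>D. \<exists>B. finite B \<and> card B \<le> C * (D + 1) ^ d \<and>
     (\<forall>f. poly_of Z D f \<longrightarrow> cut S f \<in> fs.span B))"

lemma growth_le_empty:
  fixes S :: "'s set"
  shows "growth_le S {} 0"
  unfolding growth_le_def
proof (intro exI allI conjI impI)
  fix D and f :: "'s \<Rightarrow> real" assume "poly_of {} D f"
  then obtain c where "f = (\<lambda>_. c)" using poly_of_empty by blast
  then have "cut S f = (\<lambda>s. c * cut S (\<lambda>_. 1) s)" by (auto simp: cut_def)
  moreover have "cut S (\<lambda>_. 1) \<in> fs.span {cut S (\<lambda>_. 1)}" by (intro fs.span_base) auto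
  ultimately show "cut S f \<in> fs.span {cut S (\<lambda>_. 1)}" using fs.span_scale by metis
qed auto

lemma growth_le_mono:
  assumes "growth_le S Z d" "d \<le> e" "T \<subseteq> S" "W \<subseteq> Z"
  shows "growth_le T W e"
proof -
  obtain C where C: "\<forall>D. \<exists>B. finite B \<and> card B \<le> C * (D + 1) ^ d \<and>
     (\<forall>f. poly_of Z D f \<longrightarrow> cut S f \<in> fs.span B)"
    using assms unfolding growth_le_def by blast
  show ?thesis
    unfolding growth_le_def
  proof (intro exI[of _ C] allI)
    fix D
    obtain B where B: "finite B" "card B \<le> C * (D + 1) ^ d"
      "\<forall>f. poly_of Z D f \<longrightarrow> cut S f \<in> fs.span B"
      using C by blast
    let ?u = "cut T (\<lambda>_. 1)"
    let ?B = "(\<lambda>b s. ?u s * b s) ` B"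
    have "card ?B \<le> card B" using B by (intro card_image_le)
    also have "\<dots> \<le> C * (D + 1) ^ e"
      using B(2) mult_le_mono2[OF power_increasing[OF assms(2), of "D + 1"], of C] by linarith
    finally have "card ?B \<le> C * (D + 1) ^ e" .
    moreover have "cut T f \<in> fs.span ?B" if "poly_of W D f" for f
    proof -
      have "cut T f = (\<lambda>s. ?u s * cut S f s)"
        using \<open>T \<subseteq> S\<close> by (auto simp: cut_def fun_eq_iff)
      then show ?thesis
        using span_times[of "cut S f" B ?u] B(3) poly_of_mono_set[OF that] assms by simp
    qed
    ultimately show "\<exists>B. finite B \<and> card B \<le> C * (D + 1) ^ e \<and>
      (\<forall>f. poly_of W D f \<longrightarrow> cut T f \<in> fs.span B)"
      using B(1) by blast
  qed
qed

lemma growth_le_Un: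
  assumes "growth_le S Z d" "growth_le T Z d"
  shows "growth_le (S \<union> T) Z d"
proof -
  have "growth_le (T - S) Z d" using growth_le_mono[OF assms(2)] by blast
  then obtain C' where C': "\<forall>D. \<exists>B. finite B \<and> card B \<le> C' * (D + 1) ^ d \<and>
     (\<forall>f. poly_of Z D f \<longrightarrow> cut (T - S) f \<in> fs.span B)"
    unfolding growth_le_def by blast
  obtain C where C: "\<forall>D. \<exists>B. finite B \<and> card B \<le> C * (D + 1) ^ d \<and>
     (\<forall>f. poly_of Z D f \<longrightarrow> cut S f \<in> fs.span B)"
    using assms unfolding growth_le_def by blast
  show ?thesis
    unfolding growth_le_def
  proof (intro exI[of _ "C + C'"] allI)
    fix D
    obtain B where B: "finite B" "card B \<le> C * (D + 1) ^ d"
      "\<forall>f. poly_of Z D f \<longrightarrow> cut S f \<in> fs.span B"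
      using C by blast
    obtain B' where B': "finite B'" "card B' \<le> C' * (D + 1) ^ d"
      "\<forall>f. poly_of Z D f \<longrightarrow> cut (T - S) f \<in> fs.span B'"
      using C' by blast
    have "card (B \<union> B') \<le> (C + C') * (D + 1) ^ d"
      using card_Un_le[of B B'] B(2) B'(2) by (simp add: distrib_right)
    moreover have "cut (S \<union> T) f \<in> fs.span (B \<union> B')" if "poly_of Z D f" for f
    proof -
      have "cut (S \<union> T) f = cut S f + cut (T - S) f" by (auto simp: cut_def fun_eq_iff)
      moreover have "cut S f \<in> fs.span (B \<union> B')" "cut (T - S) f \<in> fs.span (B \<union> B')"
        using B(3) B'(3) that fs.span_mono[of B "B \<union> B'"] fs.span_mono[of B' "B \<union> B'"] by auto
      ultimately show ?thesis by (simp add: fs.span_add)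
    qed
    ultimately show "\<exists>B. finite B \<and> card B \<le> (C + C') * (D + 1) ^ d \<and>
      (\<forall>f. poly_of Z D f \<longrightarrow> cut (S \<union> T) f \<in> fs.span B)"
      using B(1) B'(1) by (meson finite_Un)
  qed
qed

lemma growth_le_UN:
  assumes "finite I" "\<And>i. i \<in> I \<Longrightarrow> growth_le (T i) Z d"
  shows "growth_le (\<Union>i\<in>I. T i) Z d"
  using assms
proof (induction I rule: finite_induct)
  case empty
  have "poly_of Z D f \<Longrightarrow> cut {} f \<in> fs.span {}" for D f
    by (simp add: cut_def zero_fun_def)
  then have "growth_le {} Z d"
    unfolding growth_le_def by (intro exI[of _ 0] allI exI[of _ "{}"]) auto
  then show ?case by simp
next
  case (insert i I)
  then have "growth_le (T i \<union> (\<Union>i\<in>I. T i)) Z d" by (intro growth_le_Un) auto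
  then show ?case by simp
qed

lemma growth_le_cases:
  assumes "growth_le {s\<in>T. P s} Z d" "growth_le {s\<in>T. \<not> P s} Z d"
  shows "growth_le T Z d"
proof -
  have "T = {s\<in>T. P s} \<union> {s\<in>T. \<not> P s}" by blast
  then show ?thesis using growth_le_Un[OF assms] by simp
qed

lemma growth_le_insert:
  assumes "growth_le S Z d"
  shows "growth_le S (insert y Z) (Suc d)"
proof -
  obtain C where C: "\<forall>D. \<exists>B. finite B \<and> card B \<le> C * (D + 1) ^ d \<and>
     (\<forall>f. poly_of Z D f \<longrightarrow> cut S f \<in> fs.span B)"
    using assms unfolding growth_le_def by blast
  show ?thesis
    unfolding growth_le_def
  proof (intro exI[of _ C] allI)
    fix D
    obtain B where B: "finite B" "card B \<le> C * (D + 1) ^ d"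
      "\<forall>f. poly_of Z D f \<longrightarrow> cut S f \<in> fs.span B"
      using C by blast
    \<comment> \<open>the \<open>D + 1\<close> possible powers of \<open>y\<close> account for the additional factor\<close>
    let ?B = "\<Union>i\<in>{..D}. (\<lambda>b s. y s ^ i * b s) ` B"
    have "card ?B \<le> (\<Sum>i\<in>{..D}. card ((\<lambda>b s. y s ^ i * b s) ` B))"
      by (rule card_UN_le) simp
    also have "\<dots> \<le> (\<Sum>i\<in>{..D}. C * (D + 1) ^ d)"
      by (intro sum_mono) (meson B card_image_le le_trans)
    also have "\<dots> = C * (D + 1) ^ Suc d" by (simp add: algebra_simps)
    finally have card: "card ?B \<le> C * (D + 1) ^ Suc d" .
    have "cut S f \<in> fs.span ?B" if f: "poly_of (insert y Z) D f" for f
    proof -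
      obtain h where h: "\<forall>i. poly_of Z D (h i)" "f = (\<lambda>s. \<Sum>i\<le>D. h i s * y s ^ i)"
        using poly_of_insert_expand[OF f] by blast
      have "cut S f = (\<Sum>i\<le>D. (\<lambda>s. y s ^ i * cut S (h i) s))"
        unfolding h(2) fun_eq_iff by (auto simp: cut_def sum_fun_apply mult.commute)
      moreover have "(\<lambda>s. y s ^ i * cut S (h i) s) \<in> fs.span ?B" if "i \<le> D" for i
        using span_times[of "cut S (h i)" B "\<lambda>s. y s ^ i"] h(1) B(3)
          fs.span_mono[of "(\<lambda>b s. y s ^ i * b s) ` B" ?B] that by blast
      ultimately show ?thesis by (auto intro: fs.span_sum)
    qed
    then show "\<exists>B. finite B \<and> card B \<le> C * (D + 1) ^ Suc d \<and>
      (\<forall>f. poly_of (insert y Z) D f \<longrightarrow> cut S f \<in> fs.span B)"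
      using card B(1) by (intro exI[of _ ?B]) auto
  qed
qed

text \<open>
  The equation expresses \<open>q y\<^sup>2\<close>, so multiplying by one power of \<open>q\<close> for each power of \<open>y\<close> brings
  everything down to degree one in \<open>y\<close>.
\<close>
lemma quadratic_power_reduction:
  assumes "poly_of Z k q" "poly_of Z k r" "poly_of Z k t"
    and "\<And>s. s \<in> S \<Longrightarrow> q s * y s ^ 2 + r s * y s + t s = 0"
  shows "\<exists>\<alpha> \<beta>. poly_of Z (k * j) \<alpha> \<and> poly_of Z (k * j) \<beta> \<and>
           (\<forall>s\<in>S. q s ^ j * y s ^ j = \<alpha> s + \<beta> s * y s)"
proof (induction j)
  case 0
  show ?case
    by (rule exI[of _ "\<lambda>_. 1"], rule exI[of _ "\<lambda>_. 0"]) (auto intro: poly_of.const)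
next
  case (Suc j)
  then obtain \<alpha> \<beta> where ab: "poly_of Z (k * j) \<alpha>" "poly_of Z (k * j) \<beta>"
    "\<forall>s\<in>S. q s ^ j * y s ^ j = \<alpha> s + \<beta> s * y s" by blast
  show ?case
  proof (intro exI conjI ballI)
    show "poly_of Z (k * Suc j) (\<lambda>s. - (t s * \<beta> s))"
      using poly_of_uminus[OF poly_of.mult[OF assms(3) ab(2)]] by simp
    show "poly_of Z (k * Suc j) (\<lambda>s. q s * \<alpha> s - r s * \<beta> s)"
      using poly_of_diff[OF poly_of.mult[OF assms(1) ab(1)] poly_of.mult[OF assms(2) ab(2)]]
      by simp
    fix s assume s: "s \<in> S"
    have "q s ^ Suc j * y s ^ Suc j = (q s ^ j * y s ^ j) * (q s * y s)" by simp
    also have "\<dots> = (\<alpha> s + \<beta> s * y s) * (q s * y s)" using ab(3) s by simp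
    also have "\<dots> = \<beta> s * (q s * y s ^ 2) + q s * \<alpha> s * y s" by algebra
    also have "q s * y s ^ 2 = - r s * y s - t s" using assms(4)[OF s] by linarith
    finally show "q s ^ Suc j * y s ^ Suc j
        = - (t s * \<beta> s) + (q s * \<alpha> s - r s * \<beta> s) * y s" by (simp add: algebra_simps)
  qed
qed

text \<open>
  Multiplied by \<open>q\<^sup>D\<close>, a polynomial of degree \<open>D\<close> in \<open>Z\<close> and \<open>y\<close> becomes \<open>F + G y\<close> with \<open>F\<close> and \<open>G\<close> of
  degree \<open>O(D)\<close> in \<open>Z\<close>. Dividing the spanning functions for \<open>F\<close> and \<open>G\<close> by \<open>q\<^sup>D\<close> again, at most twice as
  many functions suffice, for a degree bound that is larger by a constant factor only.
\<close>
lemma growth_le_insert_quadratic: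
  assumes "growth_le S Z d" "poly_of Z k q" "poly_of Z k r" "poly_of Z k t"
    and eq: "\<And>s. s \<in> S \<Longrightarrow> q s * y s ^ 2 + r s * y s + t s = 0"
    and nz: "\<And>s. s \<in> S \<Longrightarrow> q s \<noteq> 0"
  shows "growth_le S (insert y Z) d"
proof -
  obtain C where C: "\<forall>D. \<exists>B. finite B \<and> card B \<le> C * (D + 1) ^ d \<and>
     (\<forall>f. poly_of Z D f \<longrightarrow> cut S f \<in> fs.span B)"
    using assms unfolding growth_le_def by blast
  show ?thesis
    unfolding growth_le_def
  proof (intro exI[of _ "2 * C * (1 + k) ^ d"] allI)
    fix D
    obtain B where B: "finite B" "card B \<le> C * (((1 + k) * D) + 1) ^ d"
      "\<forall>f. poly_of Z ((1 + k) * D) f \<longrightarrow> cut S f \<in> fs.span B"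
      using C by blast
    let ?B0 = "(\<lambda>b s. inverse (q s ^ D) * b s) ` B"
    let ?B1 = "(\<lambda>b s. (inverse (q s ^ D) * y s) * b s) ` B"
    have "card (?B0 \<union> ?B1) \<le> card ?B0 + card ?B1" by (rule card_Un_le)
    also have "\<dots> \<le> 2 * card B"
      using B(1) card_image_le[of B] by (metis (no_types, lifting) add_mono mult_2)
    also have "\<dots> \<le> 2 * (C * (((1 + k) * D) + 1) ^ d)" using B(2) by simp
    also have "\<dots> \<le> 2 * (C * ((1 + k) * (D + 1)) ^ d)"
      by (intro mult_le_mono power_mono order_refl) auto
    also have "\<dots> = 2 * C * (1 + k) ^ d * (D + 1) ^ d"
      unfolding power_mult_distrib by (simp add: ac_simps)
    finally have card: "card (?B0 \<union> ?B1) \<le> 2 * C * (1 + k) ^ d * (D + 1) ^ d" .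
    have "cut S f \<in> fs.span (?B0 \<union> ?B1)" if f: "poly_of (insert y Z) D f" for f
    proof -
      obtain h where h: "\<forall>i. poly_of Z D (h i)" "f = (\<lambda>s. \<Sum>i\<le>D. h i s * y s ^ i)"
        using poly_of_insert_expand[OF f] by blast
      have "\<forall>j. \<exists>\<alpha> \<beta>. poly_of Z (k * j) \<alpha> \<and> poly_of Z (k * j) \<beta> \<and>
           (\<forall>s\<in>S. q s ^ j * y s ^ j = \<alpha> s + \<beta> s * y s)"
        using quadratic_power_reduction[OF assms(2,3,4) eq] by blast
      then obtain \<alpha> \<beta> where ab: "\<And>j. poly_of Z (k * j) (\<alpha> j)" "\<And>j. poly_of Z (k * j) (\<beta> j)"
        "\<And>j s. s \<in> S \<Longrightarrow> q s ^ j * y s ^ j = \<alpha> j s + \<beta> j s * y s" by metis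
      define F where "F \<gamma> s = (\<Sum>i\<le>D. h i s * (q s ^ (D - i) * \<gamma> i s))"
        for \<gamma> :: "nat \<Rightarrow> 'a \<Rightarrow> real" and s
      have F: "poly_of Z ((1 + k) * D) (F \<gamma>)" if "\<And>j. poly_of Z (k * j) (\<gamma> j)" for \<gamma>
        unfolding F_def
      proof (intro poly_of_sum)
        fix i assume "i \<in> {..D}"
        then have "k * (D - i) + k * i = k * D" by (simp flip: distrib_left)
        then show "poly_of Z ((1 + k) * D) (\<lambda>s. h i s * (q s ^ (D - i) * \<gamma> i s))"
          using poly_of.mult[OF h(1)[rule_format, of i]
              poly_of.mult[OF poly_of_power[OF assms(2), of "D - i"] that[of i]]] by simp
      qed simp
      have key: "q s ^ D * f s = F \<alpha> s + F \<beta> s * y s" if s: "s \<in> S" for s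
      proof -
        have "q s ^ D * (h i s * y s ^ i)
            = h i s * (q s ^ (D - i) * (\<alpha> i s + \<beta> i s * y s))" if "i \<le> D" for i
        proof -
          have "q s ^ D = q s ^ (D - i) * q s ^ i" using that by (simp flip: power_add)
          then have "q s ^ D * (h i s * y s ^ i) = h i s * (q s ^ (D - i) * (q s ^ i * y s ^ i))"
            by (simp add: ac_simps)
          then show ?thesis using ab(3)[OF s] by simp
        qed
        then have "q s ^ D * f s = (\<Sum>i\<le>D. h i s * (q s ^ (D - i) * (\<alpha> i s + \<beta> i s * y s)))"
          unfolding h(2) sum_distrib_left by (intro sum.cong) auto
        then show ?thesis
          unfolding F_def sum_distrib_right sum.distrib[symmetric] by (simp add: algebra_simps)
      qed
      have "cut S f = (\<lambda>s. inverse (q s ^ D) * cut S (F \<alpha>) s)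
          + (\<lambda>s. (inverse (q s ^ D) * y s) * cut S (F \<beta>) s)"
      proof
        fix s
        show "cut S f s = ((\<lambda>s. inverse (q s ^ D) * cut S (F \<alpha>) s)
          + (\<lambda>s. (inverse (q s ^ D) * y s) * cut S (F \<beta>) s)) s"
        proof (cases "s \<in> S")
          case True
          then have "f s = inverse (q s ^ D) * (q s ^ D * f s)" using nz by simp
          then show ?thesis
            using True unfolding key[OF True] by (simp add: cut_def algebra_simps)
        qed (simp add: cut_def)
      qed
      moreover have "(\<lambda>s. inverse (q s ^ D) * cut S (F \<alpha>) s) \<in> fs.span (?B0 \<union> ?B1)"
        by (rule subsetD[OF fs.span_mono span_times[OF B(3)[rule_format, OF F[OF ab(1)]]]]) simp
      moreover have "(\<lambda>s. (inverse (q s ^ D) * y s) * cut S (F \<beta>) s) \<in> fs.span (?B0 \<union> ?B1)"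
        by (rule subsetD[OF fs.span_mono span_times[OF B(3)[rule_format, OF F[OF ab(2)]]]]) simp
      ultimately show ?thesis by (simp add: fs.span_add)
    qed
    then show "\<exists>B. finite B \<and> card B \<le> 2 * C * (1 + k) ^ d * (D + 1) ^ d \<and>
      (\<forall>f. poly_of (insert y Z) D f \<longrightarrow> cut S f \<in> fs.span B)"
      using card B(1) by (intro exI[of _ "?B0 \<union> ?B1"]) auto
  qed
qed

definition is_poly :: "('s \<Rightarrow> real) set \<Rightarrow> ('s \<Rightarrow> real) \<Rightarrow> bool" where
  "is_poly Z f \<longleftrightarrow> (\<exists>k. poly_of Z k f)"

lemma is_poly_const: "is_poly Z (\<lambda>_. c)"
  unfolding is_poly_def using poly_of.const by blast

lemma is_poly_gen: "z \<in> Z \<Longrightarrow> is_poly Z z"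
  unfolding is_poly_def using poly_of.gen by blast

lemma is_poly_add:
  assumes "is_poly Z f" "is_poly Z g"
  shows "is_poly Z (\<lambda>s. f s + g s)"
proof -
  obtain k l where "poly_of Z k f" "poly_of Z l g" using assms unfolding is_poly_def by blast
  then have "poly_of Z (k + l) f" "poly_of Z (k + l) g"
    by (auto intro: poly_of_mono[of Z k] poly_of_mono[of Z l])
  then show ?thesis unfolding is_poly_def using poly_of.add by blast
qed

lemma is_poly_mult: "is_poly Z f \<Longrightarrow> is_poly Z g \<Longrightarrow> is_poly Z (\<lambda>s. f s * g s)"
  unfolding is_poly_def using poly_of.mult by blast

lemma is_poly_uminus: "is_poly Z f \<Longrightarrow> is_poly Z (\<lambda>s. - f s)"
  unfolding is_poly_def using poly_of_uminus by blast

lemma is_poly_diff: "is_poly Z f \<Longrightarrow> is_poly Z g \<Longrightarrow> is_poly Z (\<lambda>s. f s - g s)"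
  using is_poly_add[OF _ is_poly_uminus, of Z f g] by simp

lemma is_poly_power: "is_poly Z f \<Longrightarrow> is_poly Z (\<lambda>s. f s ^ n)"
  unfolding is_poly_def using poly_of_power by blast

lemmas is_poly_intros = is_poly_const is_poly_add is_poly_mult is_poly_uminus is_poly_diff
  is_poly_power is_poly_gen

lemma growth_le_insert_algebraic:
  assumes "growth_le S Z d" "is_poly Z q" "is_poly Z r" "is_poly Z t"
    and "\<And>s. s \<in> S \<Longrightarrow> q s * y s ^ 2 + r s * y s + t s = 0"
    and "\<And>s. s \<in> S \<Longrightarrow> q s \<noteq> 0"
  shows "growth_le S (insert y Z) d"
proof -
  obtain k l m where "poly_of Z k q" "poly_of Z l r" "poly_of Z m t"
    using assms(2-4) unfolding is_poly_def by blast
  then have "poly_of Z (k + l + m) q" "poly_of Z (k + l + m) r" "poly_of Z (k + l + m) t"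
    by (auto intro: poly_of_mono)
  from growth_le_insert_quadratic[OF assms(1) this assms(5,6)] show ?thesis .
qed

section \<open>Polynomial relations from slow growth\<close>

lemma linear_relation:
  fixes \<mu> :: "'m \<Rightarrow> 's \<Rightarrow> real"
  assumes "finite M" "finite B" "card B < card M" "\<And>m. m \<in> M \<Longrightarrow> \<mu> m \<in> fs.span B"
  shows "\<exists>c. (\<exists>m\<in>M. c m \<noteq> 0) \<and> (\<forall>s. (\<Sum>m\<in>M. c m * \<mu> m s) = 0)"
proof (cases "inj_on \<mu> M")
  case True
  then have "card (\<mu> ` M) = card M" by (rule card_image)
  then have "fs.dependent (\<mu> ` M)"
    using fs.independent_span_bound[OF assms(2), of "\<mu> ` M"] assms(3,4) by fastforce
  then obtain u where u: "\<exists>v\<in>\<mu> ` M. u v \<noteq> 0" "(\<Sum>v\<in>\<mu> ` M. (\<lambda>s. u v * v s)) = 0"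
    using fs.dependent_finite[of "\<mu> ` M"] assms(1) by auto
  have "(\<Sum>m\<in>M. u (\<mu> m) * \<mu> m s) = 0" for s
  proof -
    have "(\<Sum>v\<in>\<mu> ` M. (\<lambda>s. u v * v s)) s = 0" using u(2) by simp
    then show ?thesis by (simp add: sum_fun_apply sum.reindex[OF True])
  qed
  then show ?thesis using u(1) by (intro exI[of _ "\<lambda>m. u (\<mu> m)"]) auto
next
  case False
  then obtain m m' where m: "m \<in> M" "m' \<in> M" "m \<noteq> m'" "\<mu> m = \<mu> m'"
    unfolding inj_on_def by blast
  have "(\<Sum>k\<in>M. (if k = m then 1 else if k = m' then -1 else 0) * \<mu> k s) = 0" for s
  proof -
    have "(\<Sum>k\<in>M. (if k = m then 1 else if k = m' then -1 else 0) * \<mu> k s)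
        = (\<Sum>k\<in>M. (if k = m then \<mu> k s else 0) - (if k = m' then \<mu> k s else 0))"
      using m(3) by (intro sum.cong) auto
    also have "\<dots> = \<mu> m s - \<mu> m' s" using m assms(1) by (simp add: sum_subtractf)
    finally show ?thesis using m(4) by simp
  qed
  then show ?thesis
    using m(1) by (intro exI[of _ "\<lambda>k. if k = m then 1 else if k = m' then -1 else 0"]) auto
qed

lemma poly_of_prod:
  "finite I \<Longrightarrow> (\<And>i. i \<in> I \<Longrightarrow> poly_of Z k (f i)) \<Longrightarrow>
    poly_of Z (card I * k) (\<lambda>s. \<Prod>i\<in>I. f i s)"
  by (induction I rule: finite_induct) (auto intro: poly_of.intros)

text \<open>
  The monomials with all exponents at most \<open>K\<close> are \<open>(K + 1)\<^sup>n\<close> many, where \<open>n\<close> is the number of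
  indeterminates. On \<open>S\<close> they lie in a space of dimension \<open>O(K\<^sup>d)\<close>, so for \<open>d < n\<close> and large \<open>K\<close> there is
  a linear relation between them.
\<close>
lemma growth_le_imp_relation:
  fixes X :: "'v \<Rightarrow> 's \<Rightarrow> real"
  assumes "growth_le S Z d" "finite E" "d < card E" "X ` E \<subseteq> Z"
  shows "\<exists>f :: 'v rpoly. f \<noteq> 0 \<and> indets f \<subseteq> E \<and> (\<forall>s\<in>S. rpoly_eval (\<lambda>e. X e s) f = 0)"
proof -
  define n where "n = card E"
  obtain C where C: "\<forall>D. \<exists>B. finite B \<and> card B \<le> C * (D + 1) ^ d \<and>
     (\<forall>f. poly_of Z D f \<longrightarrow> cut S f \<in> fs.span B)"
    using assms unfolding growth_le_def by blast
  \<comment> \<open>chosen such that \<open>C (n (K + 1))\<^sup>d = K (K + 1)\<^sup>d\<close>, which is less than \<open>(K + 1)\<^sup>d\<^sup>+\<^sup>1\<close>\<close>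
  define K where "K = C * n ^ d"
  obtain B where B: "finite B" "card B \<le> C * (n * K + 1) ^ d"
    "\<forall>f. poly_of Z (n * K) f \<longrightarrow> cut S f \<in> fs.span B"
    using C by blast
  have "n * K + 1 \<le> n * (K + 1)" using assms(3) by (simp add: n_def)
  then have "C * (n * K + 1) ^ d \<le> C * (n * (K + 1)) ^ d"
    by (intro mult_le_mono power_mono) auto
  also have "\<dots> = K * (K + 1) ^ d" by (simp only: K_def power_mult_distrib mult.assoc)
  also have "\<dots> < (K + 1) ^ Suc d" by simp
  also have "\<dots> \<le> (K + 1) ^ n"
    using assms(3) by (intro power_increasing) (auto simp: n_def)
  finally have less: "card B < (K + 1) ^ n" using B(2) by simp
  define expo where "expo g = Abs_poly_mapping (\<lambda>v. if v \<in> E then g v else (0::nat))" for g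
  have lookup_expo: "Poly_Mapping.lookup (expo g) v = (if v \<in> E then g v else 0)" for g v
    unfolding expo_def using assms(2)
    by (subst lookup_Abs_poly_mapping) (auto elim: rev_finite_subset)
  define M where "M = expo ` (PiE E (\<lambda>_. {..K}))"
  have inj: "inj_on expo (PiE E (\<lambda>_. {..K}))"
  proof (rule inj_onI)
    fix g h assume g: "g \<in> PiE E (\<lambda>_. {..K})" and h: "h \<in> PiE E (\<lambda>_. {..K})" and eq: "expo g = expo h"
    show "g = h"
    proof (rule PiE_ext[OF g h])
      fix v assume "v \<in> E"
      then show "g v = h v" using lookup_expo[of g v] lookup_expo[of h v] eq by simp
    qed
  qed
  have M: "finite M" "card M = (K + 1) ^ n"
    unfolding M_def card_image[OF inj] using assms(2) by (auto simp: card_PiE n_def finite_PiE)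
  define \<mu> where "\<mu> m s = (\<Prod>v\<in>Poly_Mapping.keys m. X v s ^ Poly_Mapping.lookup m v)" for m s
  have "poly_of Z (n * K) (\<mu> m)" if m: "m \<in> M" for m
  proof -
    obtain g where g: "g \<in> PiE E (\<lambda>_. {..K})" "m = expo g" using m unfolding M_def by blast
    have sub: "Poly_Mapping.keys m \<subseteq> E"
      by (auto simp: in_keys_iff g(2) lookup_expo split: if_splits)
    have "\<mu> m = (\<lambda>s. \<Prod>v\<in>E. X v s ^ g v)"
      unfolding \<mu>_def using sub assms(2)
      by (intro ext prod.mono_neutral_cong_left) (auto simp: in_keys_iff g(2) lookup_expo)
    moreover have "poly_of Z K (\<lambda>s. X v s ^ g v)" if v: "v \<in> E" for v
      by (rule poly_of_mono[OF poly_of_power[OF poly_of.gen[of "X v", where D = 0]]])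
         (use v g(1) assms(4) in auto)
    ultimately show ?thesis
      using poly_of_prod[OF assms(2), of Z K "\<lambda>v s. X v s ^ g v"] by (simp add: n_def)
  qed
  then have "cut S (\<mu> m) \<in> fs.span B" if "m \<in> M" for m using B(3) that by blast
  then obtain c where c: "\<exists>m\<in>M. c m \<noteq> 0" "\<forall>s. (\<Sum>m\<in>M. c m * cut S (\<mu> m) s) = 0"
    using linear_relation[of M B "\<lambda>m. cut S (\<mu> m)"] M B(1) less by auto
  define f :: "'v rpoly" where "f = Abs_poly_mapping (\<lambda>m. if m \<in> M then c m else 0)"
  have lookup_f: "Poly_Mapping.lookup f m = (if m \<in> M then c m else 0)" for m
    unfolding f_def using M(1) by (subst lookup_Abs_poly_mapping) (auto elim: rev_finite_subset)
  have keys_f: "Poly_Mapping.keys f \<subseteq> M" by (auto simp: in_keys_iff lookup_f split: if_splits)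
  have "f \<noteq> 0" using c(1) lookup_f by (metis lookup_zero)
  moreover have "indets f \<subseteq> E"
    using keys_f unfolding indets_def M_def
    by (fastforce simp: in_keys_iff lookup_expo split: if_splits)
  moreover have "rpoly_eval (\<lambda>e. X e s) f = 0" if s: "s \<in> S" for s
  proof -
    have "rpoly_eval (\<lambda>e. X e s) f = (\<Sum>m\<in>M. c m * \<mu> m s)"
      unfolding rpoly_eval_def \<mu>_def using keys_f M(1)
      by (intro sum.mono_neutral_cong_left) (auto simp: lookup_f in_keys_iff)
    then show ?thesis using c(2)[rule_format, of s] s by (simp add: cut_def)
  qed
  ultimately show ?thesis by blast
qed

section \<open>Edges inside a vertex set\<close>

definition pairs :: "nat set \<Rightarrow> (nat \<times> nat) set" where
  "pairs A = {(i, j). i \<in> A \<and> j \<in> A \<and> i < j}"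

lemma pairs_atMost: "pairs {..n} = edges n"
  by (auto simp: pairs_def edges_def)

lemma pairs_mono: "A \<subseteq> B \<Longrightarrow> pairs A \<subseteq> pairs B"
  by (auto simp: pairs_def)

lemma finite_pairs: "finite A \<Longrightarrow> finite (pairs A)"
  by (rule finite_subset[of _ "A \<times> A"]) (auto simp: pairs_def)

lemma card_pairs: "finite A \<Longrightarrow> card (pairs A) = card A choose 2"
proof (induction A rule: finite_linorder_max_induct)
  case empty
  then show ?case by (simp add: pairs_def)
next
  case (insert b A)
  have "pairs (insert b A) = pairs A \<union> A \<times> {b}" using insert by (force simp: pairs_def)
  moreover have "pairs A \<inter> A \<times> {b} = {}" using insert by (auto simp: pairs_def)
  moreover have "b \<notin> A" using insert by auto
  ultimately show ?case
    using insert finite_pairs[of A]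
    by (simp add: card_Un_disjoint card_cartesian_product numeral_2_eq_2)
qed

lemma growth_le_Un_finite:
  assumes "finite F" "growth_le S Z d"
  shows "growth_le S (F \<union> Z) (card F + d)"
  using assms
proof (induction F rule: finite_induct)
  case (insert y F)
  then show ?case using growth_le_insert[of S "F \<union> Z" "card F + d" y] by simp
qed simp

text \<open>
  A dependence among some members of a family persists in the whole family. This brings exceptional
  sets that are described by few of the edges to a common form.
\<close>
lemma growth_le_extend_family:
  assumes "growth_le S Z d" "finite E" "F \<subseteq> E" "X ` F \<subseteq> Z" "d < card F"
  shows "growth_le S (X ` E) (card E - 1)"
proof -
  have fin: "finite F" using assms finite_subset by blast
  have "growth_le S (X ` (E - F) \<union> Z) (card (X ` (E - F)) + d)"
    using growth_le_Un_finite[OF _ assms(1), of "X ` (E - F)"] assms(2) by simp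
  moreover have "card (X ` (E - F)) + d \<le> card E - 1"
  proof -
    have "card (X ` (E - F)) \<le> card (E - F)" using assms(2) by (intro card_image_le) auto
    also have "\<dots> = card E - card F" using fin assms by (simp add: card_Diff_subset)
    finally show ?thesis
      using assms(5) card_mono[OF assms(2,3)] by linarith
  qed
  moreover have "X ` E \<subseteq> X ` (E - F) \<union> Z" using assms(4) by blast
  ultimately show ?thesis using growth_le_mono by blast
qed

section \<open>Pairs of simplices with equal triangle areas\<close>

definition heron :: "real \<Rightarrow> real \<Rightarrow> real \<Rightarrow> real" where
  "heron a b c = 4 * a * b - (a + b - c)\<^sup>2"

lemma heron_scale: "heron (a * r) (b * r) (c * r) = heron a b c * r\<^sup>2"
  unfolding heron_def by algebra

text \<open>
  Subtracting the two equations gives a line \<open>2 \<sigma> a - 2 \<tau> a' = \<kappa>\<close>, and eliminating \<open>a\<close> gives a quadratic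
  equation for \<open>a'\<close>. As the curves have a point in common, its first two coefficients can vanish only
  together with the third, and then the line is a component of both curves. A hyperbola with non-zero
  right hand side contains no line, so both curves degenerate to pairs of lines.
\<close>
lemma two_hyperbolas:
  fixes a a' :: real
  assumes e1: "(a - s1)\<^sup>2 - (a' - s1')\<^sup>2 = c1" and e2: "(a - s2)\<^sup>2 - (a' - s2')\<^sup>2 = c2"
    and \<sigma>: "\<sigma> = s2 - s1" "\<sigma> \<noteq> 0" and \<tau>: "\<tau> = s2' - s1'"
    and \<kappa>: "\<kappa> = c1 - c2 + s2\<^sup>2 - s1\<^sup>2 - s2'\<^sup>2 + s1'\<^sup>2"
  shows "2 * \<sigma> * a - 2 * \<tau> * a' - \<kappa> = 0"
    and "4 * (\<tau>\<^sup>2 - \<sigma>\<^sup>2) * a'\<^sup>2 + (4 * \<tau> * (\<kappa> - 2 * \<sigma> * s1) + 8 * \<sigma>\<^sup>2 * s1') * a'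
       + ((\<kappa> - 2 * \<sigma> * s1)\<^sup>2 - 4 * \<sigma>\<^sup>2 * s1'\<^sup>2 - 4 * \<sigma>\<^sup>2 * c1) = 0" (is "?eq")
    and "4 * (\<tau>\<^sup>2 - \<sigma>\<^sup>2) = 0 \<Longrightarrow> 4 * \<tau> * (\<kappa> - 2 * \<sigma> * s1) + 8 * \<sigma>\<^sup>2 * s1' = 0 \<Longrightarrow> c1 = 0 \<and> c2 = 0"
proof -
  show lin: "2 * \<sigma> * a - 2 * \<tau> * a' - \<kappa> = 0"
    unfolding \<sigma>(1) \<tau> \<kappa> e1[symmetric] e2[symmetric] by algebra
  have "4 * \<sigma>\<^sup>2 * ((a - s1)\<^sup>2 - (a' - s1')\<^sup>2) = 4 * \<sigma>\<^sup>2 * c1" using e1 by simp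
  moreover have "4 * \<sigma>\<^sup>2 * (a - s1)\<^sup>2 = (\<kappa> + 2 * \<tau> * a' - 2 * \<sigma> * s1)\<^sup>2"
    using lin by algebra
  ultimately show eq: ?eq by algebra
  assume q: "4 * (\<tau>\<^sup>2 - \<sigma>\<^sup>2) = 0" and r: "4 * \<tau> * (\<kappa> - 2 * \<sigma> * s1) + 8 * \<sigma>\<^sup>2 * s1' = 0"
  have t: "(\<kappa> - 2 * \<sigma> * s1)\<^sup>2 - 4 * \<sigma>\<^sup>2 * s1'\<^sup>2 - 4 * \<sigma>\<^sup>2 * c1 = 0"
    using eq q r by simp
  have \<tau>2: "\<tau>\<^sup>2 = \<sigma>\<^sup>2" using q by simp
  have "\<tau> \<noteq> 0" using \<tau>2 \<sigma>(2) by auto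
  moreover have "4 * \<tau> * (\<kappa> - 2 * \<sigma> * s1 + 2 * \<tau> * s1') = 0"
    using r \<tau>2 by algebra
  ultimately have k: "\<kappa> - 2 * \<sigma> * s1 = - 2 * \<tau> * s1'" by simp
  have "4 * \<sigma>\<^sup>2 * c1 = 0" using t unfolding k using \<tau>2 by algebra
  then have c1: "c1 = 0" using \<sigma>(2) by simp
  have "c2 = 0" using k \<kappa> c1 \<sigma>(1) \<tau> \<tau>2 by algebra
  then show "c1 = 0 \<and> c2 = 0" using c1 by simp
qed

text \<open>
  The parameter \<open>s\<close> ranges over pairs of simplices; \<open>x i j s\<close> and \<open>y i j s\<close> are the squared lengths of
  their edges. The last two assumptions hold outside proper algebraic subsets. They say that the
  triangles of the first simplex have non-zero area, and that the centres \<open>(s1, s1')\<close> and \<open>(s2, s2')\<close> of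
  the two curves in \<open>two_hyperbolas\<close> differ in the first coordinate.
\<close>
locale equal_areas =
  fixes V :: "nat set" and S :: "'s set" and x y :: "nat \<Rightarrow> nat \<Rightarrow> 's \<Rightarrow> real"
  assumes x_sym: "x i j = x j i" and y_sym: "y i j = y j i"
    and x_pos: "\<lbrakk>s \<in> S; i \<in> V; j \<in> V; i \<noteq> j\<rbrakk> \<Longrightarrow> x i j s > 0"
    and y_pos: "\<lbrakk>s \<in> S; i \<in> V; j \<in> V; i \<noteq> j\<rbrakk> \<Longrightarrow> y i j s > 0"
    and areas: "\<lbrakk>s \<in> S; i \<in> V; j \<in> V; k \<in> V; distinct [i, j, k]\<rbrakk> \<Longrightarrow>
      heron (y i j s) (y i k s) (y j k s) = heron (x i j s) (x i k s) (x j k s)"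
    and nondeg: "\<lbrakk>s \<in> S; i \<in> V; j \<in> V; k \<in> V; distinct [i, j, k]\<rbrakk> \<Longrightarrow>
      heron (x i j s) (x i k s) (x j k s) \<noteq> 0"
    and regular: "\<lbrakk>s \<in> S; i \<in> V; j \<in> V; k \<in> V; l \<in> V; distinct [i, j, k, l]\<rbrakk> \<Longrightarrow>
      x i k s + x i l s \<noteq> x j k s + x j l s"
begin

text \<open>
  The ratios \<open>y / x\<close> at two edges with common vertex \<open>i\<close> are reciprocal to each other. This is the
  degeneracy condition for one of the two hyperbolas.
\<close>
definition recip :: "nat \<Rightarrow> nat \<Rightarrow> nat \<Rightarrow> 's \<Rightarrow> bool" where
  "recip i k l s \<longleftrightarrow> y i k s * y i l s = x i k s * x i l s"

definition all_recip :: "nat set \<Rightarrow> nat \<Rightarrow> 's \<Rightarrow> bool" where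
  "all_recip A e s \<longleftrightarrow> (\<forall>i\<in>A. \<forall>k\<in>A. i \<noteq> k \<longrightarrow> recip i k e s)"

definition agree :: "nat set \<Rightarrow> 's \<Rightarrow> bool" where
  "agree A s \<longleftrightarrow> (\<forall>i\<in>A. \<forall>j\<in>A. i \<noteq> j \<longrightarrow> x i j s = y i j s)"

abbreviation adjoin :: "nat \<Rightarrow> nat \<Rightarrow> ('s \<Rightarrow> real) set \<Rightarrow> ('s \<Rightarrow> real) set" where
  "adjoin i j Z \<equiv> insert (y i j) (insert (x i j) Z)"

definition coords :: "nat set \<Rightarrow> ('s \<Rightarrow> real) set" where
  "coords A = (\<Union>i\<in>A. \<Union>j\<in>A - {i}. {x i j, y i j})"

definition star :: "nat \<Rightarrow> nat set \<Rightarrow> ('s \<Rightarrow> real) set" where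
  "star e A = (\<Union>i\<in>A. {x i e, y i e})"

lemma coordsD: "coords A \<subseteq> Z \<Longrightarrow> i \<in> A \<Longrightarrow> j \<in> A \<Longrightarrow> i \<noteq> j \<Longrightarrow> x i j \<in> Z \<and> y i j \<in> Z"
  unfolding coords_def by blast

lemma coords_insert: "coords (insert e A) \<subseteq> coords A \<union> star e A"
  unfolding coords_def star_def using x_sym[of e] y_sym[of e] by auto

lemma growth_two: "growth_le T Z d \<Longrightarrow> growth_le T (adjoin i j Z) (d + 2)"
  using growth_le_insert[OF growth_le_insert] by fastforce

lemma growth_triangle:
  assumes "growth_le T Z d" "T \<subseteq> S" "i \<in> V" "k \<in> V" "l \<in> V" "distinct [i, k, l]"
    and Z: "x i k \<in> Z \<and> y i k \<in> Z" "x i l \<in> Z \<and> y i l \<in> Z"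
  shows "growth_le T (adjoin k l Z) (d + 1)"
proof (rule growth_le_insert_algebraic)
  show "growth_le T (insert (x k l) Z) (d + 1)" using growth_le_insert[OF assms(1)] by simp
  show "is_poly (insert (x k l) Z) (\<lambda>_. 1)"
    by (intro is_poly_intros)
  show "is_poly (insert (x k l) Z) (\<lambda>s. - (2 * (y i k s + y i l s)))"
    using Z by (intro is_poly_intros) auto
  show "is_poly (insert (x k l) Z) (\<lambda>s. (y i k s + y i l s)\<^sup>2 - 4 * y i k s * y i l s
     + (4 * x i k s * x i l s - (x i k s + x i l s - x k l s)\<^sup>2))"
    using Z by (intro is_poly_intros) auto
next
  fix s assume "s \<in> T"
  then have "heron (y i k s) (y i l s) (y k l s) = heron (x i k s) (x i l s) (x k l s)"
    using areas assms by (meson subsetD)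
  then show "1 * y k l s ^ 2 + (- (2 * (y i k s + y i l s))) * y k l s
     + ((y i k s + y i l s)\<^sup>2 - 4 * y i k s * y i l s
        + (4 * x i k s * x i l s - (x i k s + x i l s - x k l s)\<^sup>2)) = 0"
    unfolding heron_def by algebra
qed simp

text \<open>
  The reciprocity relation determines the new \<open>y\<close> rationally, just as a triangle determines it
  algebraically. So it replaces the triangle equation where no triangle is available yet.
\<close>
lemma growth_recip:
  assumes "growth_le T Z d" "T \<subseteq> S" "i \<in> V" "k \<in> V" "i \<noteq> k"
    and Z: "x i k \<in> Z \<and> y i k \<in> Z"
    and recip: "\<And>s. s \<in> T \<Longrightarrow> recip i k l s"
  shows "growth_le T (adjoin i l Z) (d + 1)"
proof (rule growth_le_insert_algebraic)
  show "growth_le T (insert (x i l) Z) (d + 1)" using growth_le_insert[OF assms(1)] by simp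
  show "is_poly (insert (x i l) Z) (y i k)"
    "is_poly (insert (x i l) Z) (\<lambda>s. - (x i k s * x i l s))"
    "is_poly (insert (x i l) Z) (\<lambda>_. 0)"
    using Z by (intro is_poly_intros; auto)+
next
  fix s assume s: "s \<in> T"
  then show "y i k s \<noteq> 0" using y_pos assms by (metis less_irrefl subsetD)
  show "y i k s * (y i l s)\<^sup>2 + - (x i k s * x i l s) * y i l s + 0 = 0"
    using recip[OF s] unfolding recip_def by algebra
qed

lemma growth_agree:
  assumes "growth_le T Z d" "\<And>s. s \<in> T \<Longrightarrow> x k l s = y k l s"
  shows "growth_le T (adjoin k l Z) (d + 1)"
proof (rule growth_le_insert_algebraic)
  show "growth_le T (insert (x k l) Z) (d + 1)" using growth_le_insert[OF assms(1)] by simp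
  show "is_poly (insert (x k l) Z) (\<lambda>_. 1)"
    "is_poly (insert (x k l) Z) (\<lambda>s. - x k l s)"
    "is_poly (insert (x k l) Z) (\<lambda>_. 0)"
    by (intro is_poly_intros; auto)+
  show "1 * (y k l s)\<^sup>2 + - x k l s * y k l s + 0 = 0" if "s \<in> T" for s
    using assms(2)[OF that] by (simp add: power2_eq_square)
qed simp

text \<open>
  The second coordinate is a root of the quadratic equation of \<open>two_hyperbolas\<close>, and then the first
  one is determined by the linear equation.
\<close>
lemma growth_two_triangles:
  assumes "growth_le T Z d" "T \<subseteq> S" "i \<in> V" "j \<in> V" "k \<in> V" "l \<in> V" "distinct [i, j, k, l]"
    and Z: "x i k \<in> Z \<and> y i k \<in> Z" "x i l \<in> Z \<and> y i l \<in> Z"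
           "x j k \<in> Z \<and> y j k \<in> Z" "x j l \<in> Z \<and> y j l \<in> Z"
    and nr: "\<And>s. s \<in> T \<Longrightarrow> \<not> (recip i k l s \<and> recip j k l s)"
  shows "growth_le T (adjoin k l Z) d"
proof -
  define s1 where "s1 s = x i k s + x i l s" for s
  define s2 where "s2 s = x j k s + x j l s" for s
  define s1' where "s1' s = y i k s + y i l s" for s
  define s2' where "s2' s = y j k s + y j l s" for s
  define c1 where "c1 s = 4 * (x i k s * x i l s) - 4 * (y i k s * y i l s)" for s
  define c2 where "c2 s = 4 * (x j k s * x j l s) - 4 * (y j k s * y j l s)" for s
  define \<sigma> where "\<sigma> s = s2 s - s1 s" for s
  define \<tau> where "\<tau> s = s2' s - s1' s" for s
  define \<kappa> where "\<kappa> s = c1 s - c2 s + (s2 s)\<^sup>2 - (s1 s)\<^sup>2 - (s2' s)\<^sup>2 + (s1' s)\<^sup>2" for s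
  define q where "q s = 4 * ((\<tau> s)\<^sup>2 - (\<sigma> s)\<^sup>2)" for s
  define r where "r s = 4 * \<tau> s * (\<kappa> s - 2 * \<sigma> s * s1 s) + 8 * (\<sigma> s)\<^sup>2 * s1' s" for s
  define t where "t s = (\<kappa> s - 2 * \<sigma> s * s1 s)\<^sup>2 - 4 * (\<sigma> s)\<^sup>2 * (s1' s)\<^sup>2 - 4 * (\<sigma> s)\<^sup>2 * c1 s" for s
  have P: "is_poly W s1" "is_poly W s2" "is_poly W s1'" "is_poly W s2'" "is_poly W c1" "is_poly W c2"
    if "Z \<subseteq> W" for W
    unfolding s1_def[abs_def] s2_def[abs_def] s1'_def[abs_def] s2'_def[abs_def]
      c1_def[abs_def] c2_def[abs_def]
    using Z that by (intro is_poly_intros; blast)+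
  have P2: "is_poly W \<sigma>" "is_poly W \<tau>" "is_poly W \<kappa>" if "Z \<subseteq> W" for W
    unfolding \<sigma>_def[abs_def] \<tau>_def[abs_def] \<kappa>_def[abs_def]
    by (intro is_poly_intros(1-6) P that)+
  have P3: "is_poly Z q" "is_poly Z r" "is_poly Z t"
    unfolding q_def[abs_def] r_def[abs_def] t_def[abs_def]
    by (intro is_poly_intros(1-6) P P2 order_refl)+
  have key: "\<sigma> s \<noteq> 0" "2 * \<sigma> s * x k l s - 2 * \<tau> s * y k l s - \<kappa> s = 0"
     "q s * (y k l s)\<^sup>2 + r s * y k l s + t s = 0" "q s \<noteq> 0 \<or> r s \<noteq> 0"
    if "s \<in> T" for s
  proof -
    have s: "s \<in> S" using assms that by blast
    have h1: "heron (y i k s) (y i l s) (y k l s) = heron (x i k s) (x i l s) (x k l s)"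
      using assms by (intro areas[OF s]) auto
    have h2: "heron (y j k s) (y j l s) (y k l s) = heron (x j k s) (x j l s) (x k l s)"
      using assms by (intro areas[OF s]) auto
    show nz: "\<sigma> s \<noteq> 0"
      using regular[OF s assms(3-7)] by (simp add: \<sigma>_def s1_def s2_def)
    have e1: "(x k l s - s1 s)\<^sup>2 - (y k l s - s1' s)\<^sup>2 = c1 s"
      using h1 unfolding heron_def s1_def s1'_def c1_def by algebra
    have e2: "(x k l s - s2 s)\<^sup>2 - (y k l s - s2' s)\<^sup>2 = c2 s"
      using h2 unfolding heron_def s2_def s2'_def c2_def by algebra
    note * = two_hyperbolas[OF e1 e2 \<sigma>_def nz \<tau>_def \<kappa>_def, folded q_def r_def t_def]
    show "2 * \<sigma> s * x k l s - 2 * \<tau> s * y k l s - \<kappa> s = 0"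
      "q s * (y k l s)\<^sup>2 + r s * y k l s + t s = 0"
      using *(1,2) by auto
    show "q s \<noteq> 0 \<or> r s \<noteq> 0"
      using *(3) nr[OF that] unfolding recip_def c1_def c2_def by auto
  qed
  have "growth_le T (insert (y k l) Z) d"
  proof (rule growth_le_cases[where P = "\<lambda>s. q s \<noteq> 0"])
    show "growth_le {s \<in> T. q s \<noteq> 0} (insert (y k l) Z) d"
      by (rule growth_le_insert_algebraic[OF growth_le_mono[OF assms(1)] P3]) (use key in auto)
    show "growth_le {s \<in> T. \<not> q s \<noteq> 0} (insert (y k l) Z) d"
    \<comment> \<open>here the equation is linear in the new function; multiplied by that function it is quadratic\<close>
    proof (rule growth_le_insert_algebraic[OF growth_le_mono[OF assms(1)] P3(2,3) is_poly_const[of _ 0]])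
      fix s assume "s \<in> {s \<in> T. \<not> q s \<noteq> 0}"
      then have "r s * y k l s + t s = 0" using key(3)[of s] by simp
      then show "r s * (y k l s)\<^sup>2 + t s * y k l s + 0 = 0" by algebra
    qed (use key in auto)
  qed
  then have "growth_le T (insert (x k l) (insert (y k l) Z)) d"
  proof (rule growth_le_insert_algebraic)
    let ?W = "insert (y k l) Z"
    have "is_poly ?W (y k l)" by (intro is_poly_gen) auto
    then show "is_poly ?W (\<lambda>s. 2 * \<sigma> s)" "is_poly ?W (\<lambda>s. - (2 * \<tau> s * y k l s + \<kappa> s))" "is_poly ?W (\<lambda>s. 0)"
      by (intro is_poly_intros(1-6) P2; blast)+
    fix s assume "s \<in> T"
    then show "2 * \<sigma> s * (x k l s)\<^sup>2 + - (2 * \<tau> s * y k l s + \<kappa> s) * x k l s + 0 = 0"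
      "2 * \<sigma> s \<noteq> 0" using key(1,2)[of s] by (algebra, simp)
  qed
  then show ?thesis by (simp add: insert_commute)
qed

text \<open>
  If the last edge \<open>c d\<close> is in degenerate position, it raises the dimension by \<open>1\<close> instead of \<open>0\<close>. But
  then \<open>a d\<close> raised it only by \<open>1\<close> instead of \<open>2\<close>, by reciprocity with \<open>a c\<close>.
\<close>
lemma growth_tetrahedron_aux:
  assumes V: "a \<in> V" "b \<in> V" "c \<in> V" "d \<in> V" and dist: "distinct [a, b, c, d]" and T: "T \<subseteq> S"
  shows "growth_le T (adjoin c d (adjoin b d (adjoin a d (adjoin b c (adjoin a c (adjoin a b {})))))) 8"
proof -
  have *: "growth_le U (adjoin b c (adjoin a c (adjoin a b {}))) 5" if "U \<subseteq> S" for U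
    using growth_triangle[OF growth_two[OF growth_two[OF growth_le_empty]] that, of a b c a c a b]
      V dist by (simp add: numeral_eq_Suc)
  show ?thesis
  proof (rule growth_le_cases[where P = "\<lambda>s. recip a c d s \<and> recip b c d s"])
    let ?U = "{s \<in> T. recip a c d s \<and> recip b c d s}"
    have U: "?U \<subseteq> S" using T by blast
    note 1 = growth_recip[OF *[OF U] U, of a c d]
    note 2 = growth_triangle[OF 1 U, of a b d]
    note 3 = growth_triangle[OF 2 U, of a c d]
    show "growth_le ?U (adjoin c d (adjoin b d (adjoin a d (adjoin b c (adjoin a c (adjoin a b {})))))) 8"
      using 3 V dist by simp
  next
    let ?U = "{s \<in> T. \<not> (recip a c d s \<and> recip b c d s)}"
    have U: "?U \<subseteq> S" using T by blast
    note 1 = growth_two[OF *[OF U], of a d]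
    note 2 = growth_triangle[OF 1 U, of a b d]
    note 3 = growth_two_triangles[OF 2 U, of a b c d]
    show "growth_le ?U (adjoin c d (adjoin b d (adjoin a d (adjoin b c (adjoin a c (adjoin a b {})))))) 8"
      using 3 V dist by simp
  qed
qed

lemma coords_four:
  "coords {a, b, c, d} \<subseteq> adjoin c d (adjoin b d (adjoin a d (adjoin b c (adjoin a c (adjoin a b {})))))"
  unfolding coords_def
  using x_sym[of b a] x_sym[of c a] x_sym[of d a] x_sym[of c b] x_sym[of d b] x_sym[of d c]
    y_sym[of b a] y_sym[of c a] y_sym[of d a] y_sym[of c b] y_sym[of d b] y_sym[of d c]
  by auto

lemma card4E:
  assumes "card A = 4"
  obtains a b c d where "A = {a, b, c, d}" "distinct [a, b, c, d]"
proof -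
  have "card A = Suc (Suc (Suc (Suc 0)))" using assms by simp
  then show thesis using that by (auto simp: card_Suc_eq)
qed

lemma growth_tetrahedron:
  assumes "A \<subseteq> V" "card A = 4" "T \<subseteq> S"
  shows "growth_le T (coords A) 8"
proof -
  obtain a b c d where A: "A = {a, b, c, d}" "distinct [a, b, c, d]"
    using card4E[OF assms(2)] .
  show ?thesis
    using growth_le_mono[OF growth_tetrahedron_aux[of a b c d T] order_refl order_refl coords_four]
      A assms by simp
qed

lemma growth_tetrahedron_agree:
  assumes "card A = 4" and agree: "\<And>s. s \<in> T \<Longrightarrow> agree A s"
  shows "growth_le T (coords A) 6"
proof -
  obtain a b c d where A: "A = {a, b, c, d}" "distinct [a, b, c, d]"
    using card4E[OF assms(1)] .
  have *: "x i j s = y i j s" if "s \<in> T" "i \<in> A" "j \<in> A" "i \<noteq> j" for i j s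
    using agree[OF that(1)] that unfolding agree_def by blast
  note 1 = growth_agree[OF growth_le_empty, of T a b]
  note 2 = growth_agree[OF 1, of a c]
  note 3 = growth_agree[OF 2, of b c]
  note 4 = growth_agree[OF 3, of a d]
  note 5 = growth_agree[OF 4, of b d]
  note 6 = growth_agree[OF 5, of c d]
  have "growth_le T (adjoin c d (adjoin b d (adjoin a d (adjoin b c (adjoin a c (adjoin a b {})))))) 6"
    using 6 * A by (simp add: numeral_eq_Suc)
  then show ?thesis
    using growth_le_mono[OF _ order_refl order_refl coords_four] A(1) by blast
qed

text \<open>
  By the last hypothesis, \<open>c e\<close> does not raise the dimension. Either \<open>d e\<close> does not raise it either, or
  there is a reciprocity relation by which the first edge \<open>a e\<close> raises it by \<open>1\<close> instead of \<open>2\<close>.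
\<close>
lemma growth_vertex_aux:
  assumes V: "a \<in> V" "b \<in> V" "c \<in> V" "d \<in> V" "e \<in> V" and dist: "distinct [a, b, c, d, e]"
    and T: "T \<subseteq> S" and Z: "coords {a, b, c, d} \<subseteq> Z" and g: "growth_le T Z m"
    and nr: "\<And>s. s \<in> T \<Longrightarrow> \<not> recip a c e s"
  shows "growth_le T (adjoin d e (adjoin c e (adjoin b e (adjoin a e Z)))) (m + 3)"
proof -
  have known: "x a b \<in> Z \<and> y a b \<in> Z" "x a c \<in> Z \<and> y a c \<in> Z" "x b c \<in> Z \<and> y b c \<in> Z"
      "x a d \<in> Z \<and> y a d \<in> Z" "x b d \<in> Z \<and> y b d \<in> Z"
    using coordsD[OF Z] dist by auto
  show ?thesis
  proof (rule growth_le_cases[where P = "\<lambda>s. recip a d e s \<and> recip b d e s"])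
    let ?U = "{s \<in> T. recip a d e s \<and> recip b d e s}"
    have U: "?U \<subseteq> S" "?U \<subseteq> T" using T by auto
    have "growth_le ?U Z m" by (rule growth_le_mono[OF g order_refl U(2) order_refl])
    then have "growth_le ?U (adjoin a e Z) (m + 1)"
      by (rule growth_recip[OF _ U(1), of _ _ a d]) (use V dist known in auto)
    then have "growth_le ?U (adjoin b e (adjoin a e Z)) (m + 1 + 1)"
      by (rule growth_triangle[OF _ U(1), of _ _ a]) (use V dist known in auto)
    then have "growth_le ?U (adjoin c e (adjoin b e (adjoin a e Z))) (m + 1 + 1)"
      by (rule growth_two_triangles[OF _ U(1), of _ _ a b]) (use V dist known nr in auto)
    then have "growth_le ?U (adjoin d e (adjoin c e (adjoin b e (adjoin a e Z)))) (m + 1 + 1 + 1)"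
      by (rule growth_triangle[OF _ U(1), of _ _ a]) (use V dist known in auto)
    then show "growth_le ?U (adjoin d e (adjoin c e (adjoin b e (adjoin a e Z)))) (m + 3)"
      by (simp add: numeral_eq_Suc)
  next
    let ?U = "{s \<in> T. \<not> (recip a d e s \<and> recip b d e s)}"
    have U: "?U \<subseteq> S" "?U \<subseteq> T" using T by auto
    have "growth_le ?U Z m" by (rule growth_le_mono[OF g order_refl U(2) order_refl])
    then have "growth_le ?U (adjoin a e Z) (m + 2)"
      by (rule growth_two)
    then have "growth_le ?U (adjoin b e (adjoin a e Z)) (m + 2 + 1)"
      by (rule growth_triangle[OF _ U(1), of _ _ a]) (use V dist known in auto)
    then have "growth_le ?U (adjoin c e (adjoin b e (adjoin a e Z))) (m + 2 + 1)"
      by (rule growth_two_triangles[OF _ U(1), of _ _ a b]) (use V dist known nr in auto)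
    then have "growth_le ?U (adjoin d e (adjoin c e (adjoin b e (adjoin a e Z)))) (m + 2 + 1)"
      by (rule growth_two_triangles[OF _ U(1), of _ _ a b]) (use V dist known in auto)
    then show "growth_le ?U (adjoin d e (adjoin c e (adjoin b e (adjoin a e Z)))) (m + 3)"
      by (simp add: numeral_eq_Suc)
  qed
qed

text \<open>
  Some ordering of the vertices of \<open>A\<close> satisfies the hypothesis of the ordered version; which one
  depends on \<open>s\<close>, so \<open>T\<close> is cut into finitely many parts.
\<close>
lemma growth_vertex:
  assumes A: "A \<subseteq> V" "card A = 4" and e: "e \<in> V" "e \<notin> A"
    and T: "T \<subseteq> S" and Z: "coords A \<subseteq> Z" and g: "growth_le T Z m"
    and nr: "\<And>s. s \<in> T \<Longrightarrow> \<not> all_recip A e s"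
  shows "growth_le T (Z \<union> star e A) (m + 3)"
proof -
  have fin: "finite A" using A(2) card_ge_0_finite[of A] by simp
  let ?I = "{(i, k). i \<in> A \<and> k \<in> A \<and> i \<noteq> k}"
  let ?T = "\<lambda>(i, k). {s \<in> T. \<not> recip i k e s}"
  have "growth_le (?T p) (Z \<union> star e A) (m + 3)" if p: "p \<in> ?I" for p
  proof -
    obtain a c where ac: "p = (a, c)" "a \<in> A" "c \<in> A" "a \<noteq> c" using p by auto
    have "card (A - {a, c}) = 2" using ac fin A(2) by (simp add: card_Diff_subset)
    then obtain b d where bd: "A - {a, c} = {b, d}" "b \<noteq> d" by (auto simp: card_2_iff)
    have eqA: "A = {a, b, c, d}" using bd(1) ac by blast
    have dist: "distinct [a, b, c, d, e]" using ac bd e(2) eqA by auto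
    have "growth_le (?T p) (adjoin d e (adjoin c e (adjoin b e (adjoin a e Z)))) (m + 3)"
    proof (rule growth_vertex_aux[OF _ _ _ _ e(1) dist])
      show "?T p \<subseteq> S" using T ac(1) by auto
      show "growth_le (?T p) Z m"
        by (rule growth_le_mono[OF g order_refl _ order_refl]) (simp add: ac(1))
      show "coords {a, b, c, d} \<subseteq> Z" using Z eqA by simp
      show "\<And>s. s \<in> ?T p \<Longrightarrow> \<not> recip a c e s" by (simp add: ac(1))
    qed (use A(1) eqA in auto)
    moreover have "Z \<union> star e A = adjoin d e (adjoin c e (adjoin b e (adjoin a e Z)))"
      unfolding eqA star_def by auto
    ultimately show ?thesis by simp
  qed
  moreover have "finite ?I" by (rule finite_subset[of _ "A \<times> A"]) (use fin in auto)
  ultimately have "growth_le (\<Union>p\<in>?I. ?T p) (Z \<union> star e A) (m + 3)" by (intro growth_le_UN)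
  moreover have "T \<subseteq> (\<Union>p\<in>?I. ?T p)" using nr unfolding all_recip_def by fastforce
  ultimately show ?thesis using growth_le_mono by blast
qed

text \<open>
  Five vertices have ten edges, more than this bound. So two simplices that agree on a tetrahedron,
  the first of them generic, have all reciprocity relations at every further vertex. The count is
  \<open>6 + 3\<close>, since agreement leaves one free coordinate for each edge of the tetrahedron.
\<close>
lemma growth_not_all_recip_agree:
  assumes "A \<subseteq> V" "card A = 4" "e \<in> V" "e \<notin> A"
  shows "growth_le {s \<in> S. agree A s \<and> \<not> all_recip A e s} (coords (insert e A)) 9"
proof -
  let ?T = "{s \<in> S. agree A s \<and> \<not> all_recip A e s}"
  have "growth_le ?T (coords A \<union> star e A) (6 + 3)"
    using assms by (intro growth_vertex growth_tetrahedron_agree) auto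
  then show ?thesis using growth_le_mono[OF _ _ order_refl coords_insert] by simp
qed

text \<open>
  Six vertices have \<open>15\<close> edges. This is the count \<open>8 + 3 + 3 + 0\<close>: the last edge \<open>e f\<close> closes triangles
  with \<open>a\<close> and a second vertex of \<open>A\<close>, and is not in degenerate position by the third condition.
\<close>
lemma growth_not_all_recip_twice:
  assumes "A \<subseteq> V" "card A = 4" "e \<in> V" "e \<notin> A" "f \<in> V" "f \<notin> A" "e \<noteq> f" "a \<in> A"
  shows "growth_le {s \<in> S. \<not> all_recip A e s \<and> \<not> all_recip A f s \<and> \<not> recip a e f s}
           (coords (insert f (insert e A))) 14"
proof -
  let ?T = "{s \<in> S. \<not> all_recip A e s \<and> \<not> all_recip A f s \<and> \<not> recip a e f s}"
  let ?Z = "coords A \<union> star e A \<union> star f A"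
  have "growth_le ?T ?Z (8 + 3 + 3)"
    using assms by (intro growth_vertex growth_tetrahedron) auto
  moreover obtain j where j: "j \<in> A" "j \<noteq> a"
    using card4E[OF assms(2)] by (metis distinct_length_2_or_more insertCI)
  ultimately have "growth_le ?T (adjoin e f ?Z) 14"
    using assms by (intro growth_two_triangles[of ?T ?Z 14 a j e f]) (auto simp: star_def)
  moreover have "star f (insert e A) \<subseteq> adjoin e f ?Z" "star e A \<subseteq> ?Z" "coords A \<subseteq> ?Z"
    by (auto simp: star_def)
  then have "coords (insert f (insert e A)) \<subseteq> adjoin e f ?Z"
    using coords_insert[of f "insert e A"] coords_insert[of e A] by blast
  ultimately show ?thesis using growth_le_mono by blast
qed

text \<open>
  By the relations at a vertex \<open>i\<close>, the ratio \<open>y / x\<close> at every edge \<open>i k\<close> of \<open>A\<close> is the reciprocal \<open>\<rho> i\<close> of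
  the ratio at \<open>i e\<close>. The edge \<open>i k\<close> belongs to \<open>i\<close> and to \<open>k\<close>, so \<open>\<rho>\<close> is constant, and \<open>y\<close> is
  proportional to \<open>x\<close> on \<open>A\<close>. Equal non-zero areas make the factor \<open>1\<close>.
\<close>
lemma all_recip_imp_agree:
  assumes A: "A \<subseteq> V" "card A = 4" "e \<in> V" "e \<notin> A" and s: "s \<in> S" and r: "all_recip A e s"
  shows "agree (insert e A) s"
proof -
  define \<rho> where "\<rho> i = x i e s / y i e s" for i
  have pos: "x i j s > 0" "y i j s > 0" if "i \<in> insert e A" "j \<in> insert e A" "i \<noteq> j" for i j
    using x_pos[OF s, of i j] y_pos[OF s, of i j] that A by auto
  have y: "y i k s = x i k s * \<rho> i" if "i \<in> A" "k \<in> A" "i \<noteq> k" for i k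
  proof -
    have "y i k s * y i e s = x i k s * x i e s"
      using r that unfolding all_recip_def recip_def by blast
    moreover have "y i e s > 0" using pos[of i e] that A by auto
    ultimately show ?thesis by (simp add: \<rho>_def field_simps)
  qed
  have \<rho>: "\<rho> i = \<rho> k" if "i \<in> A" "k \<in> A" for i k
  proof (cases "i = k")
    case False
    then have "x i k s * \<rho> i = x i k s * \<rho> k"
      using y[OF that] y[OF that(2,1)] x_sym[of k i] y_sym[of k i] by simp
    then show ?thesis using pos[of i k] that False by simp
  qed simp
  obtain a b c d where abcd: "A = {a, b, c, d}" "distinct [a, b, c, d]"
    using card4E[OF A(2)] .
  have "heron (x a b s) (x a c s) (x b c s) * (\<rho> a)\<^sup>2 = heron (x a b s) (x a c s) (x b c s)"
    using areas[OF s, of a b c] abcd A y[of a b] y[of a c] y[of b c] \<rho>[of b a] by (simp add: heron_scale)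
  then have "(\<rho> a)\<^sup>2 = 1" using nondeg[OF s, of a b c] abcd A by simp
  moreover have "\<rho> a > 0" using pos[of a e] abcd A by (auto simp: \<rho>_def)
  ultimately have "\<rho> a = 1" by (auto simp: power2_eq_1_iff)
  then have 1: "\<rho> i = 1" if "i \<in> A" for i using \<rho>[of i a] that abcd by simp
  have e: "x i e s = y i e s" if "i \<in> A" for i
    using 1[OF that] pos[of i e] that A by (auto simp: \<rho>_def)
  show ?thesis
    unfolding agree_def
  proof (intro ballI impI)
    fix i j assume ij: "i \<in> insert e A" "j \<in> insert e A" "i \<noteq> j"
    then consider "i = e" "j \<in> A" | "j = e" "i \<in> A" | "i \<in> A" "j \<in> A" by blast
    then show "x i j s = y i j s"
    proof cases
      case 1
      then show ?thesis using e[of j] x_sym[of e j] y_sym[of e j] by simp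
    next
      case 2
      then show ?thesis using e[of i] by simp
    next
      case 3
      then show ?thesis using y[OF 3 ij(3)] 1 by simp
    qed
  qed
qed

text \<open>
  Agreement passes from a tetrahedron to each further vertex. For an edge \<open>i j\<close>, first exchange a
  vertex of the tetrahedron for \<open>i\<close>, then add \<open>j\<close>.
\<close>
lemma agree_spreads:
  assumes s: "s \<in> S" and A: "A \<subseteq> V" "card A = 4" "agree A s"
    and r: "\<And>B e. \<lbrakk>B \<subseteq> V; card B = 4; e \<in> V; e \<notin> B; agree B s\<rbrakk> \<Longrightarrow> all_recip B e s"
  shows "agree V s"
proof -
  have step: "agree (insert e B) s" if "B \<subseteq> V" "card B = 4" "agree B s" "e \<in> V" for B e
    using all_recip_imp_agree[OF _ _ _ _ s r] that by (cases "e \<in> B") (auto simp: insert_absorb)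
  have "x i j s = y i j s" if ij: "i \<in> V" "j \<in> V" "i \<noteq> j" for i j
  proof -
    have "\<exists>B. B \<subseteq> V \<and> card B = 4 \<and> agree B s \<and> i \<in> B"
    proof (cases "i \<in> A")
      case False
      obtain a where a: "a \<in> A" using A(2) by fastforce
      have "finite A" using A(2) card_ge_0_finite[of A] by simp
      then have "card (insert i (A - {a})) = 4" using a False A(2) by simp
      moreover have "agree (insert i (A - {a})) s"
        using step[OF A ij(1)] unfolding agree_def by blast
      ultimately show ?thesis using A(1) ij(1) by (intro exI[of _ "insert i (A - {a})"]) auto
    qed (use A in blast)
    then obtain B where B: "B \<subseteq> V" "card B = 4" "agree B s" "i \<in> B" by blast
    show ?thesis using step[OF B(1-3) ij(2)] B(4) ij(3) unfolding agree_def by blast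
  qed
  then show ?thesis unfolding agree_def by blast
qed

text \<open>
  Either some vertex has all reciprocity relations with some tetrahedron and agreement spreads from
  there, or every two adjacent edges have reciprocal ratios. In the second case the three edges of a
  triangle have pairwise reciprocal positive ratios, which are therefore \<open>1\<close>.
\<close>
lemma agree_if_unexceptional:
  assumes s: "s \<in> S" and V: "finite V" "card V \<ge> 6"
    and r1: "\<And>A e. \<lbrakk>A \<subseteq> V; card A = 4; e \<in> V; e \<notin> A; agree A s\<rbrakk> \<Longrightarrow> all_recip A e s"
    and r2: "\<And>A e f a. \<lbrakk>A \<subseteq> V; card A = 4; e \<in> V; e \<notin> A; f \<in> V; f \<notin> A; e \<noteq> f; a \<in> A\<rbrakk> \<Longrightarrow>
       all_recip A e s \<or> all_recip A f s \<or> recip a e f s"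
  shows "agree V s"
proof (cases "\<exists>A e. A \<subseteq> V \<and> card A = 4 \<and> e \<in> V \<and> e \<notin> A \<and> all_recip A e s")
  case True
  then obtain A e where "A \<subseteq> V" "card A = 4" "e \<in> V" "e \<notin> A" "all_recip A e s" by blast
  then have "agree A s" using all_recip_imp_agree[OF _ _ _ _ s] unfolding agree_def by blast
  then show ?thesis using agree_spreads[OF s \<open>A \<subseteq> V\<close> \<open>card A = 4\<close> _ r1] by blast
next
  case False
  have rec: "recip a e f s" if "a \<in> V" "e \<in> V" "f \<in> V" "distinct [a, e, f]" for a e f
  proof -
    have "card (V - {a, e, f}) \<ge> 3" using that V by (simp add: card_Diff_subset)
    then obtain B where B: "B \<subseteq> V - {a, e, f}" "card B = 3" "finite B"
      by (meson obtain_subset_with_card_n)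
    then have "a \<notin> B" by blast
    then have "card (insert a B) = 4" using B(2,3) by simp
    moreover have "insert a B \<subseteq> V" "e \<notin> insert a B" "f \<notin> insert a B" using B that by auto
    ultimately show ?thesis using r2[of "insert a B" e f a] False that by auto
  qed
  have "x i j s = y i j s" if ij: "i \<in> V" "j \<in> V" "i \<noteq> j" for i j
  proof -
    have "card (V - {i, j}) \<ge> 1" using that V by (simp add: card_Diff_subset)
    then obtain k where k: "k \<in> V" "k \<noteq> i" "k \<noteq> j"
      by (metis Diff_iff One_nat_def card.empty ex_in_conv insertCI not_one_le_zero)
    let ?p = "x i j s" and ?q = "x i k s" and ?r = "x j k s"
    let ?P = "y i j s" and ?Q = "y i k s" and ?R = "y j k s"
    have e: "?P * ?Q = ?p * ?q" "?P * ?R = ?p * ?r" "?Q * ?R = ?q * ?r"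
      using rec[of i j k] rec[of j i k] rec[of k i j] ij k
        x_sym[of j i] y_sym[of j i] x_sym[of k i] y_sym[of k i] x_sym[of k j] y_sym[of k j]
      unfolding recip_def by auto
    have pos: "?p > 0" "?q > 0" "?r > 0" "?P > 0"
      using x_pos[OF s] y_pos[OF s] ij k by auto
    have "?P\<^sup>2 * (?q * ?r) = ?p\<^sup>2 * (?q * ?r)"
      using e by algebra
    then have "?P\<^sup>2 = ?p\<^sup>2" using pos by simp
    then show ?thesis using pos by (simp add: power2_eq_iff_nonneg)
  qed
  then show ?thesis unfolding agree_def by blast
qed

end

section \<open>Disagreeing pairs have slow growth\<close>

lemma growth_heron_zero:
  assumes "\<And>s. s \<in> T \<Longrightarrow> heron (a s) (b s) (c s) = 0"
  shows "growth_le T {a, b, c} 2"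
proof -
  have "growth_le T {b, a} 2"
    using growth_le_insert[OF growth_le_insert[OF growth_le_empty]] by (simp add: numeral_2_eq_2)
  then have "growth_le T (insert c {b, a}) 2"
  proof (rule growth_le_insert_algebraic)
    show "is_poly {b, a} (\<lambda>_. 1)" "is_poly {b, a} (\<lambda>s. - (2 * (a s + b s)))"
      "is_poly {b, a} (\<lambda>s. (a s + b s)\<^sup>2 - 4 * a s * b s)"
      by (intro is_poly_intros; simp)+
    show "1 * (c s)\<^sup>2 + - (2 * (a s + b s)) * c s + ((a s + b s)\<^sup>2 - 4 * a s * b s) = 0"
      if "s \<in> T" for s
      using assms[OF that] unfolding heron_def by algebra
  qed simp
  then show ?thesis by (simp add: insert_commute)
qed

lemma growth_sum_eq:
  assumes "\<And>s. s \<in> T \<Longrightarrow> a s + b s = c s + d s"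
  shows "growth_le T {a, b, c, d} 3"
proof -
  have "growth_le T {d, c, b} 3"
    using growth_le_insert[OF growth_le_insert[OF growth_le_insert[OF growth_le_empty]]]
    by (simp add: numeral_3_eq_3)
  then have "growth_le T (insert a {d, c, b}) 3"
  proof (rule growth_le_insert_algebraic)
    show "is_poly {d, c, b} (\<lambda>_. 1)" "is_poly {d, c, b} (\<lambda>s. - (c s + d s - b s))"
      "is_poly {d, c, b} (\<lambda>_. 0)"
      by (intro is_poly_intros; simp)+
    show "1 * (a s)\<^sup>2 + - (c s + d s - b s) * a s + 0 = 0" if "s \<in> T" for s
      using assms[OF that] by algebra
  qed simp
  then show ?thesis by (simp add: insert_commute)
qed

text \<open>
  A pair of different simplices either violates one of the two regularity assumptions, and then there is
  an explicit relation between few edges of the first one, or it belongs to one of the finitely many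
  exceptional sets of the dimension count. On each of them the edge lengths of the first simplex have
  slower growth than independent functions.
\<close>
lemma growth_disagreement:
  fixes x y :: "nat \<Rightarrow> nat \<Rightarrow> 's \<Rightarrow> real"
  assumes V: "finite V" "card V \<ge> 6"
    and x_sym: "\<And>i j. x i j = x j i" and y_sym: "\<And>i j. y i j = y j i"
    and x_pos: "\<And>s i j. \<lbrakk>s \<in> S; i \<in> V; j \<in> V; i \<noteq> j\<rbrakk> \<Longrightarrow> x i j s > 0"
    and y_pos: "\<And>s i j. \<lbrakk>s \<in> S; i \<in> V; j \<in> V; i \<noteq> j\<rbrakk> \<Longrightarrow> y i j s > 0"
    and areas: "\<And>s i j k. \<lbrakk>s \<in> S; i \<in> V; j \<in> V; k \<in> V; distinct [i, j, k]\<rbrakk> \<Longrightarrow>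
      heron (y i j s) (y i k s) (y j k s) = heron (x i j s) (x i k s) (x j k s)"
    and disagree: "\<And>s. s \<in> S \<Longrightarrow> \<exists>i\<in>V. \<exists>j\<in>V. i \<noteq> j \<and> x i j s \<noteq> y i j s"
  shows "growth_le S ((\<lambda>(i, j). x i j) ` pairs V) (card (pairs V) - 1)"
proof -
  let ?X = "\<lambda>(i, j). x i j"
  let ?thin = "\<lambda>T. growth_le T (?X ` pairs V) (card (pairs V) - 1)"
  have thinI: "?thin T"
    if "growth_le T Z d" "A \<subseteq> V" "d < card A choose 2" "?X ` pairs A \<subseteq> Z" for T Z d A
  proof -
    have "finite A" using that(2) V(1) finite_subset by blast
    then show ?thesis
      using growth_le_extend_family[OF that(1) finite_pairs[OF V(1)] pairs_mono[OF that(2)] that(4)]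
        that(3) by (simp add: card_pairs)
  qed
  define S0 where "S0 = {s \<in> S.
      (\<forall>i\<in>V. \<forall>j\<in>V. \<forall>k\<in>V. distinct [i, j, k] \<longrightarrow> heron (x i j s) (x i k s) (x j k s) \<noteq> 0) \<and>
      (\<forall>i\<in>V. \<forall>j\<in>V. \<forall>k\<in>V. \<forall>l\<in>V. distinct [i, j, k, l] \<longrightarrow> x i k s + x i l s \<noteq> x j k s + x j l s)}"
  have S0: "S0 \<subseteq> S" by (auto simp: S0_def)
  interpret equal_areas V S0 x y
  proof
    fix i j k l and s :: 's
    assume "s \<in> S0"
    then have s: "s \<in> S" using S0 by blast
    show "i \<in> V \<Longrightarrow> j \<in> V \<Longrightarrow> i \<noteq> j \<Longrightarrow> x i j s > 0" by (rule x_pos[OF s])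
    show "i \<in> V \<Longrightarrow> j \<in> V \<Longrightarrow> i \<noteq> j \<Longrightarrow> y i j s > 0" by (rule y_pos[OF s])
    show "\<lbrakk>i \<in> V; j \<in> V; k \<in> V; distinct [i, j, k]\<rbrakk> \<Longrightarrow>
      heron (y i j s) (y i k s) (y j k s) = heron (x i j s) (x i k s) (x j k s)"
      by (rule areas[OF s])
    show "\<lbrakk>i \<in> V; j \<in> V; k \<in> V; distinct [i, j, k]\<rbrakk> \<Longrightarrow> heron (x i j s) (x i k s) (x j k s) \<noteq> 0"
      using \<open>s \<in> S0\<close> unfolding S0_def by blast
    show "\<lbrakk>i \<in> V; j \<in> V; k \<in> V; l \<in> V; distinct [i, j, k, l]\<rbrakk> \<Longrightarrow> x i k s + x i l s \<noteq> x j k s + x j l s"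
      using \<open>s \<in> S0\<close> unfolding S0_def by blast
  qed (use x_sym y_sym in auto)
  have X_coords: "?X ` pairs A \<subseteq> coords A" for A
    unfolding pairs_def coords_def by fastforce
  define I3 where "I3 = {(i, j, k). {i, j, k} \<subseteq> V \<and> distinct [i, j, k]}"
  define I4 where "I4 = {(i, j, k, l). {i, j, k, l} \<subseteq> V \<and> distinct [i, j, k, l]}"
  define J1 where "J1 = {(A, e). A \<subseteq> V \<and> card A = 4 \<and> e \<in> V - A}"
  define J2 where "J2 = {(A, e, f, a). A \<subseteq> V \<and> card A = 4 \<and> e \<in> V - A \<and> f \<in> V - A \<and> e \<noteq> f \<and> a \<in> A}"
  define T3 where "T3 = (\<lambda>(i, j, k). {s. heron (x i j s) (x i k s) (x j k s) = 0})"
  define T4 where "T4 = (\<lambda>(i, j, k, l). {s. x i k s + x i l s = x j k s + x j l s})"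
  define U1 where "U1 = (\<lambda>(A, e). {s \<in> S0. agree A s \<and> \<not> all_recip A e s})"
  define U2 where "U2 = (\<lambda>(A, e, f, a). {s \<in> S0. \<not> all_recip A e s \<and> \<not> all_recip A f s \<and> \<not> recip a e f s})"
  have finA: "finite A" if "A \<subseteq> V" for A using that V(1) finite_subset by blast
  have "finite I3" by (rule finite_subset[of _ "V \<times> V \<times> V"]) (use V in \<open>auto simp: I3_def\<close>)
  then have 3: "?thin (\<Union>u\<in>I3. T3 u)"
  proof (rule growth_le_UN)
    fix u assume "u \<in> I3"
    then obtain i j k where u: "u = (i, j, k)" "{i, j, k} \<subseteq> V" "distinct [i, j, k]"
      unfolding I3_def by blast
    show "?thin (T3 u)"
    proof (rule thinI[OF growth_heron_zero[of _ "x i j" "x i k" "x j k"] u(2)])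
      show "2 < card {i, j, k} choose 2" using u(3) by (simp add: choose_two)
      show "?X ` pairs {i, j, k} \<subseteq> {x i j, x i k, x j k}"
        using x_sym[of j i] x_sym[of k i] x_sym[of k j] by (auto simp: pairs_def)
    qed (simp add: T3_def u(1))
  qed
  have "finite I4" by (rule finite_subset[of _ "V \<times> V \<times> V \<times> V"]) (use V in \<open>auto simp: I4_def\<close>)
  then have 4: "?thin (\<Union>u\<in>I4. T4 u)"
  proof (rule growth_le_UN)
    fix u assume "u \<in> I4"
    then obtain i j k l where u: "u = (i, j, k, l)" "{i, j, k, l} \<subseteq> V" "distinct [i, j, k, l]"
      unfolding I4_def by blast
    have "growth_le (T4 u) {x i k, x i l, x j k, x j l} 3"
      by (rule growth_sum_eq) (simp add: T4_def u(1))
    \<comment> \<open>the two remaining edges of the tetrahedron cost at most one dimension each\<close>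
    then have g: "growth_le (T4 u) (insert (x i j) (insert (x k l) {x i k, x i l, x j k, x j l})) (Suc (Suc 3))"
      by (intro growth_le_insert)
    show "?thin (T4 u)"
    proof (rule thinI[OF g u(2)])
      show "Suc (Suc 3) < card {i, j, k, l} choose 2" using u(3) by (simp add: choose_two)
      show "?X ` pairs {i, j, k, l} \<subseteq> insert (x i j) (insert (x k l) {x i k, x i l, x j k, x j l})"
        using x_sym[of j i] x_sym[of k i] x_sym[of k j] x_sym[of l i] x_sym[of l j] x_sym[of l k]
        by (auto simp: pairs_def)
    qed
  qed
  have "finite J1" by (rule finite_subset[of _ "Pow V \<times> V"]) (use V in \<open>auto simp: J1_def\<close>)
  then have 1: "?thin (\<Union>u\<in>J1. U1 u)"
  proof (rule growth_le_UN)
    fix u assume "u \<in> J1"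
    then obtain A e where u: "u = (A, e)" "A \<subseteq> V" "card A = 4" "e \<in> V" "e \<notin> A"
      unfolding J1_def by blast
    have "growth_le (U1 u) (coords (insert e A)) 9"
      using growth_not_all_recip_agree[OF u(2-5)] by (simp add: U1_def u(1))
    then show "?thin (U1 u)"
      by (rule thinI[OF _ _ _ X_coords]) (use u finA[OF u(2)] in \<open>auto simp: choose_two\<close>)
  qed
  have "finite J2"
    by (rule finite_subset[of _ "Pow V \<times> V \<times> V \<times> V"]) (use V in \<open>auto simp: J2_def\<close>)
  then have 2: "?thin (\<Union>u\<in>J2. U2 u)"
  proof (rule growth_le_UN)
    fix u assume "u \<in> J2"
    then obtain A e f a where u: "u = (A, e, f, a)" "A \<subseteq> V" "card A = 4" "e \<in> V" "e \<notin> A"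
      "f \<in> V" "f \<notin> A" "e \<noteq> f" "a \<in> A"
      unfolding J2_def by blast
    have "growth_le (U2 u) (coords (insert f (insert e A))) 14"
      using growth_not_all_recip_twice[OF u(2-9)] by (simp add: U2_def u(1))
    then show "?thin (U2 u)"
      by (rule thinI[OF _ _ _ X_coords]) (use u finA[OF u(2)] in \<open>auto simp: choose_two\<close>)
  qed
  have cover: "s \<in> (\<Union>u\<in>I3. T3 u) \<union> (\<Union>u\<in>I4. T4 u) \<union> (\<Union>u\<in>J1. U1 u) \<union> (\<Union>u\<in>J2. U2 u)" if s: "s \<in> S" for s
  proof (rule ccontr)
    assume no: "s \<notin> (\<Union>u\<in>I3. T3 u) \<union> (\<Union>u\<in>I4. T4 u) \<union> (\<Union>u\<in>J1. U1 u) \<union> (\<Union>u\<in>J2. U2 u)"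
    have n3: "s \<notin> T3 (i, j, k)" if "(i, j, k) \<in> I3" for i j k using no that by blast
    have n1: "s \<notin> U1 (A, e)" if "(A, e) \<in> J1" for A e using no that by blast
    have n2: "s \<notin> U2 (A, e, f, a)" if "(A, e, f, a) \<in> J2" for A e f a using no that by blast
    have n4: "s \<notin> T4 (i, j, k, l)" if "(i, j, k, l) \<in> I4" for i j k l using no that by blast
    have s0: "s \<in> S0" using s n3 n4 unfolding S0_def I3_def I4_def T3_def T4_def by simp
    have "agree V s"
    proof (rule agree_if_unexceptional[OF s0 V])
      fix A e assume "A \<subseteq> V" "card A = 4" "e \<in> V" "e \<notin> A" "agree A s"
      moreover from this have "s \<notin> U1 (A, e)" by (intro n1) (simp add: J1_def)
      ultimately show "all_recip A e s" using s0 by (simp add: U1_def)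
    next
      fix A e f a assume "A \<subseteq> V" "card A = 4" "e \<in> V" "e \<notin> A" "f \<in> V" "f \<notin> A" "e \<noteq> f" "a \<in> A"
      then have "s \<notin> U2 (A, e, f, a)" by (intro n2) (simp add: J2_def)
      then show "all_recip A e s \<or> all_recip A f s \<or> recip a e f s" using s0 by (simp add: U2_def)
    qed
    then show False using disagree[OF s] unfolding agree_def by blast
  qed
  show ?thesis
    by (rule growth_le_mono[OF growth_le_Un[OF growth_le_Un[OF growth_le_Un[OF 3 4] 1] 2]
          order_refl subsetI[OF cover] order_refl])
qed

section \<open>Congruence from edge lengths\<close>

text \<open>
  The edge vectors at \<open>p 0\<close> form a basis, and by polarization their inner products are determined by
  the edge lengths. So the linear map that carries them to the edge vectors at \<open>p' 0\<close> is orthogonal.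
\<close>
lemma congruent_simplices_if_dist_eq:
  fixes p p' :: "nat \<Rightarrow> 'a::euclidean_space"
  assumes "DIM('a) = n" "labelled_simplex n p"
    and dist: "\<And>i j. i \<le> n \<Longrightarrow> j \<le> n \<Longrightarrow> dist (p' i) (p' j) = dist (p i) (p j)"
  shows "congruent_simplices n p p'"
proof -
  have inj: "inj_on p {..n}" and aff: "\<not> affine_dependent (p ` {..n})"
    using assms(2) by (auto simp: labelled_simplex_def)
  define B where "B = (\<lambda>i. p i - p 0) ` {1..n}"
  have "(\<lambda>x. - p 0 + x) ` (p ` {..n} - {p 0}) = B"
  proof -
    have "p ` {..n} - {p 0} = p ` ({..n} - {0})"
      using inj by (subst inj_on_image_set_diff[OF inj]) auto
    moreover have "{..n} - {0} = {1..n}" by auto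
    ultimately show ?thesis by (simp add: B_def image_image)
  qed
  then have indep: "independent B"
    using aff affine_dependent_iff_dependent2[of "p 0" "p ` {..n}"] by auto
  have "inj_on (\<lambda>i. p i - p 0) {1..n}" using inj by (auto simp: inj_on_def)
  then have "card B = n" by (simp add: B_def card_image)
  then have span: "span B = UNIV"
    using card_ge_dim_independent[of B UNIV] indep assms(1) by (auto simp: dim_UNIV)
  obtain L where L: "linear L" "\<And>b. b \<in> B \<Longrightarrow> L b = p' (the_inv_into {..n} p (b + p 0)) - p' 0"
    using linear_independent_extend[OF indep, of "\<lambda>b. p' (the_inv_into {..n} p (b + p 0)) - p' 0"]
    by blast
  have Lp: "L (p i - p 0) = p' i - p' 0" if "i \<le> n" for i
  proof (cases "i = 0")
    case True
    then show ?thesis using L(1) by (simp add: linear_0)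
  next
    case False
    then have "p i - p 0 \<in> B" using that by (auto simp: B_def)
    then show ?thesis using L(2) the_inv_into_f_f[OF inj] that by simp
  qed
  have polar: "(b - a) \<bullet> (c - a) = ((dist b a)\<^sup>2 + (dist c a)\<^sup>2 - (dist b c)\<^sup>2) / 2" for a b c :: 'a
    by (simp add: dist_norm power2_norm_eq_inner inner_diff inner_commute)
  have "L v \<bullet> L w = v \<bullet> w" if "v \<in> B" "w \<in> B" for v w
    using that Lp unfolding B_def by (auto simp: polar dist)
  moreover have "bilinear (\<lambda>v w. L v \<bullet> L w)"
    using L(1) by (auto simp: bilinear_def linear_iff inner_left_distrib inner_right_distrib)
  moreover have "bilinear (\<lambda>v w :: 'a. v \<bullet> w)"
    by (auto simp: bilinear_def linear_iff inner_left_distrib inner_right_distrib)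
  ultimately have "L v \<bullet> L w = v \<bullet> w" for v w
    using bilinear_eq[of "\<lambda>v w. L v \<bullet> L w" "\<lambda>v w. v \<bullet> w" UNIV B UNIV B v w] span by auto
  then have orth: "orthogonal_transformation L"
    using L(1) by (simp add: orthogonal_transformation_def)
  define g where "g x = p' 0 + L (x - p 0)" for x
  have "bij g"
  proof -
    have "g = (\<lambda>x. p' 0 + x) \<circ> L \<circ> (\<lambda>x. x - p 0)" by (auto simp: g_def)
    moreover have "bij (\<lambda>x. x - p 0)" using bij_diff_right by blast
    ultimately show ?thesis
      using orthogonal_transformation_bij[OF orth] bij_plus_right by (metis bij_comp bij_plus)
  qed
  moreover have "dist (g x) (g y) = dist x y" for x y
    using orthogonal_transformation_norm[OF orth, of "x - y"] L(1)
    by (simp add: g_def dist_norm linear_diff)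
  moreover have "g (p i) = p' i" if "i \<le> n" for i using Lp[OF that] by (simp add: g_def)
  ultimately show ?thesis unfolding congruent_simplices_def by blast
qed

lemma triangle_area_heron:
  "triangle_area a b c = sqrt (heron ((dist a b)\<^sup>2) ((dist a c)\<^sup>2) ((dist b c)\<^sup>2)) / 4"
proof -
  have "u * v - ((u + v - w) / 2)\<^sup>2 = heron u v w / 4" for u v w
    unfolding heron_def by (simp add: power_divide)
  then show ?thesis
    unfolding triangle_area_dist by (simp only: real_sqrt_divide real_sqrt_four)
qed

lemma triangle_area_swap:
  "triangle_area b a c = triangle_area a b c" "triangle_area a c b = triangle_area a b c"
proof -
  have "heron v u w = heron u v w" "heron u w v = heron u v w" "heron w v u = heron u v w" for u v w
    unfolding heron_def by algebra+
  then show "triangle_area b a c = triangle_area a b c" "triangle_area a c b = triangle_area a b c"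
    unfolding triangle_area_heron by (metis dist_commute)+
qed

theorem corollary1p3:
  fixes n :: nat
  assumes "CARD('n::finite) = n" and "n \<ge> 5"
  shows "\<exists>f :: (nat \<times> nat) rpoly. f \<noteq> 0 \<and> indets f \<subseteq> edges n \<and>
           (\<forall>p :: nat \<Rightarrow> real ^ 'n.
              labelled_simplex n p \<and> rpoly_eval (sq_edge_length p) f \<noteq> 0 \<longrightarrow>
              (\<forall>p' :: nat \<Rightarrow> real ^ 'n.
                 labelled_simplex n p' \<and>
                 (\<forall>i j k. i < j \<and> j < k \<and> k \<le> n \<longrightarrow>
                    triangle_area (p' i) (p' j) (p' k) = triangle_area (p i) (p j) (p k)) \<longrightarrow>
                 congruent_simplices n p p'))"
proof -
  define x :: "nat \<Rightarrow> nat \<Rightarrow> (nat \<Rightarrow> real ^ 'n) \<times> (nat \<Rightarrow> real ^ 'n) \<Rightarrow> real"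
    where "x i j s = (dist (fst s i) (fst s j))\<^sup>2" for i j s
  define y :: "nat \<Rightarrow> nat \<Rightarrow> (nat \<Rightarrow> real ^ 'n) \<times> (nat \<Rightarrow> real ^ 'n) \<Rightarrow> real"
    where "y i j s = (dist (snd s i) (snd s j))\<^sup>2" for i j s
  define S :: "((nat \<Rightarrow> real ^ 'n) \<times> (nat \<Rightarrow> real ^ 'n)) set" where
    "S = {(p, p'). labelled_simplex n p \<and> labelled_simplex n p' \<and>
       (\<forall>i j k. i < j \<and> j < k \<and> k \<le> n \<longrightarrow>
          triangle_area (p' i) (p' j) (p' k) = triangle_area (p i) (p j) (p k)) \<and>
       (\<exists>i\<le>n. \<exists>j\<le>n. i \<noteq> j \<and> dist (p i) (p j) \<noteq> dist (p' i) (p' j))}"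
  have "growth_le S ((\<lambda>(i, j). x i j) ` pairs {..n}) (card (pairs {..n}) - 1)"
  proof (rule growth_disagreement[where y = y])
    show "x i j = x j i" "y i j = y j i" for i j
      by (auto simp: x_def y_def dist_commute)
    fix s i j k assume s: "s \<in> S"
    obtain p p' where pp: "s = (p, p')" by (cases s)
    have "inj_on p {..n}" "inj_on p' {..n}" using s by (auto simp: S_def pp labelled_simplex_def)
    then show "x i j s > 0" "y i j s > 0" if "i \<in> {..n}" "j \<in> {..n}" "i \<noteq> j"
      using that by (auto simp: x_def y_def pp inj_on_def)
    have "x u v s \<noteq> y u v s" if "dist (p u) (p v) \<noteq> dist (p' u) (p' v)" for u v
      using that by (simp add: x_def y_def pp)
    moreover have "\<exists>u\<le>n. \<exists>v\<le>n. u \<noteq> v \<and> dist (p u) (p v) \<noteq> dist (p' u) (p' v)"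
      using s by (simp add: S_def pp)
    ultimately show "\<exists>i\<in>{..n}. \<exists>j\<in>{..n}. i \<noteq> j \<and> x i j s \<noteq> y i j s"
      by (meson atMost_iff)
    assume ijk: "i \<in> {..n}" "j \<in> {..n}" "k \<in> {..n}" "distinct [i, j, k]"
    have area: "triangle_area (p' i) (p' j) (p' k) = triangle_area (p i) (p j) (p k)"
      if "i < j" "j < k" "k \<le> n" for i j k
      using s that by (auto simp: S_def pp)
    have "triangle_area (p' i) (p' j) (p' k) = triangle_area (p i) (p j) (p k)"
    proof -
      consider "i < j" "j < k" | "i < k" "k < j" | "j < i" "i < k" | "j < k" "k < i"
        | "k < i" "i < j" | "k < j" "j < i" using ijk(4) by fastforce
      then show ?thesis
        by cases (use area ijk(1-3) triangle_area_swap in \<open>metis atMost_iff\<close>)+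
    qed
    then show "heron (y i j s) (y i k s) (y j k s) = heron (x i j s) (x i k s) (x j k s)"
      unfolding x_def y_def pp by (simp add: triangle_area_heron)
  qed (use assms(2) in auto)
  moreover have "(\<lambda>(i, j). x i j) = (\<lambda>e s. sq_edge_length (fst s) e)"
    by (auto simp: x_def sq_edge_length_def fun_eq_iff)
  ultimately have g: "growth_le S ((\<lambda>e s. sq_edge_length (fst s) e) ` edges n) (card (edges n) - 1)"
    by (simp add: pairs_atMost)
  have "(0, 1) \<in> edges n" using assms(2) by (simp add: edges_def)
  moreover have fin: "finite (edges n)" using finite_pairs[of "{..n}"] by (simp add: pairs_atMost)
  ultimately have "card (edges n) - 1 < card (edges n)"
    by (metis card_gt_0_iff diff_less empty_iff less_one)
  then obtain f :: "(nat \<times> nat) rpoly" where f: "f \<noteq> 0" "indets f \<subseteq> edges n"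
    "\<And>s. s \<in> S \<Longrightarrow> rpoly_eval (sq_edge_length (fst s)) f = 0"
    using growth_le_imp_relation[OF g fin _ order_refl] by blast
  show ?thesis
  proof (intro exI conjI allI impI)
    fix p p' :: "nat \<Rightarrow> real ^ 'n"
    assume p: "labelled_simplex n p \<and> rpoly_eval (sq_edge_length p) f \<noteq> 0"
      and p': "labelled_simplex n p' \<and> (\<forall>i j k. i < j \<and> j < k \<and> k \<le> n \<longrightarrow>
        triangle_area (p' i) (p' j) (p' k) = triangle_area (p i) (p j) (p k))"
    have "(p, p') \<notin> S" using f(3)[of "(p, p')"] p by auto
    then have "\<forall>i\<le>n. \<forall>j\<le>n. i = j \<or> dist (p i) (p j) = dist (p' i) (p' j)"
      using p p' by (auto simp: S_def)
    then have "dist (p' i) (p' j) = dist (p i) (p j)" if "i \<le> n" "j \<le> n" for i j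
      using that by (metis dist_self)
    then show "congruent_simplices n p p'"
      using p assms(1) by (intro congruent_simplices_if_dist_eq) auto
  qed (use f in auto)
qed

end
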